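(* Let $\Re\alpha>0$. For all $t$ with $\Re t>0$, the fractional integral of order $\alpha$ of the modified Bessel function of the first kind with respect to the order is $$D_{\nu-\nu_{0}}^{-\alpha}I_{\nu}(t)=\frac{1}{\pi}\left\{\int_{0}^{\pi}e^{t\cos x}x^{-\alpha}\,\Re\left(e^{i(\nu x-\pi\alpha/2)}P\left(\alpha,ix(\nu-\nu_{0})\right)\right)dx-\int_{0}^{\infty}e^{-t\cosh x}\,\Im\left(e^{(i\pi-x)\nu}\frac{P\left(\alpha,(i\pi-x)(\nu-\nu_{0})\right)}{(i\pi-x)^{\alpha}}\right)dx\right\}.$$
   Context: $I_\nu(t)=\left(\frac t2\right)^{\nu}\sum_{k=0}^{\infty}\frac{(t/2)^{2k}}{k!\,\Gamma(\nu+k+1)}$ is the modified Bessel function of the first kind. Fractional integration of order $\alpha$, $\Re\alpha>0$, is defined by $$D_{\nu-\nu_0}^{-\alpha}f(\nu)=\frac{1}{\Gamma(\alpha)}\int_{\nu_0}^{\nu}(\nu-\mu)^{\alpha-1}f(\mu)\,d\mu ,$$ and $D_{\nu-\nu_0}^{-\alpha}I_\nu(t)$ means this with $f(\mu)=I_\mu(t)$ and $t$ fixed. $P(a,z)=\frac{1}{\Gamma(a)}\int_0^z u^{a-1}e^{-u}\,du$, $\Re a>0$, is the regularized lower incomplete gamma function. $\Re$ and $\Im$ denote real and imaginary parts.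
   Formalization: Orders are real with ν₀ ≤ ν. The formula is proved as written for real α > 0; for non-real α, where it fails as written (e.g. large real t), Re F(α) and Im F(α) are replaced by (F(α)+conj F(conj α))/2 and (F(α)−conj F(conj α))/(2i). *)

theory Defs
  imports "HOL-Complex_Analysis.Complex_Analysis"
begin

(* Modified Bessel function of the first kind, principal branch of the power. At a pole,
   Gamma = 0 and x / 0 = 0, so the terms with \<nu> + k + 1 a non-positive integer vanish,
   which is the usual convention 1 / Gamma = 0 there. *)
definition bessel_I :: "complex \<Rightarrow> complex \<Rightarrow> complex" where
  "bessel_I \<nu> t =
     (t / 2) powr \<nu> * (\<Sum>k. (t / 2) ^ (2 * k) / (fact k * Gamma (\<nu> + of_nat k + 1)))"

(* f is the function of a real variable to be integrated; \<nu>0 \<le> \<nu> is intended, so that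
   (\<nu> - \<mu>) powr (\<alpha> - 1) has a non-negative base. *)
definition frac_integral :: "complex \<Rightarrow> real \<Rightarrow> (real \<Rightarrow> complex) \<Rightarrow> real \<Rightarrow> complex" where
  "frac_integral \<alpha> \<nu>0 f \<nu> =
     1 / Gamma \<alpha> * integral {\<nu>0..\<nu>} (\<lambda>\<mu>. of_real (\<nu> - \<mu>) powr (\<alpha> - 1) * f \<mu>)"

(* The path is the segment from 0 to z and the power is the principal one; for z off the
   negative real axis this is the principal branch of P(a, z). *)
definition reg_lower_gamma :: "complex \<Rightarrow> complex \<Rightarrow> complex" where
  "reg_lower_gamma a z =
     1 / Gamma a * contour_integral (linepath 0 z) (\<lambda>u. u powr (a - 1) * exp (- u))"

(* Real and imaginary part of an expression F depending on a parameter \<alpha>, continued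
   holomorphically from real to complex \<alpha>: for holomorphic F they are holomorphic in \<alpha>,
   and they are Re (F \<alpha>) and Im (F \<alpha>) when \<alpha> is real (next two lemmas). *)
definition Re_cont :: "(complex \<Rightarrow> complex) \<Rightarrow> complex \<Rightarrow> complex" where
  "Re_cont F \<alpha> = (F \<alpha> + cnj (F (cnj \<alpha>))) / 2"

definition Im_cont :: "(complex \<Rightarrow> complex) \<Rightarrow> complex \<Rightarrow> complex" where
  "Im_cont F \<alpha> = (F \<alpha> - cnj (F (cnj \<alpha>))) / (2 * \<i>)"

lemma Re_cont_real: "\<alpha> \<in> \<real> \<Longrightarrow> Re_cont F \<alpha> = of_real (Re (F \<alpha>))"
  by (simp add: Re_cont_def Reals_cnj_iff complex_add_cnj)

lemma Im_cont_real: "\<alpha> \<in> \<real> \<Longrightarrow> Im_cont F \<alpha> = of_real (Im (F \<alpha>))"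
  by (simp add: Im_cont_def Reals_cnj_iff complex_diff_cnj field_simps)

end

(* Schlaefli's integral writes I_mu(t), for real mu and Re t > 0, as an integral of
   exp (t cos x) cos (mu x) over [0, pi] minus one of exp (-t cosh x - mu x) sin (pi mu) over
   [0, oo). By Fubini it remains to integrate exp (z mu), z = i x or z = i pi - x, to fractional
   order in mu, and the substitution u = z (nu - mu) turns this into an incomplete gamma function.

   Schlaefli's integral comes from Hankel's contour integral for r^s / Gamma (s + 1), taken along
   the circle |u| = |r| and both sides of a ray, by summing over s = mu + k with r = t / 2. No
   contour deformation is needed for Hankel's formula: its right-hand side H(s, r) satisfies
   dH(s, r)/dr = H(s - 1, r) and s H(s, r) = r H(s - 1, r), so it is c(s) r^s; for s < 0 the
   limit r -> 0 and the reflection formula give c(s), and the recurrence does the rest. *)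
theory Submission
  imports Defs
begin

section \<open>Integrals over subsets of the real line\<close>

text \<open>Scaling the contour by \<open>r\<close>, with \<open>u = r * exp (\<i> * x)\<close> on
  the circle and \<open>u = - r * exp x\<close> on the ray, takes \<open>r\<close> out of the limits
  of integration: it enters only through \<open>exp (r * E x)\<close>. Hence a derivative in
  \<open>r\<close> merely shifts \<open>s\<close> by one, up to sign. The price is a ray in the
  direction of \<open>- r\<close>, not along the negative axis. Complex \<open>r\<close> is needed
  because \<open>t\<close> is complex, and negative \<open>s\<close> because \<nu>0 may be negative;
  the constant is still found from real \<open>r\<close> alone. The order \<open>s = 0\<close> is
  the one gap in the recurrence, which there reads \<open>0 = r * hankel (- 1) r\<close>. For
  complex \<alpha> the kernel \<open>(\<nu> - \<mu>) powr (\<alpha> - 1)\<close> is not real, so a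
  plain real part would conjugate it as well. In \<open>cnj (F (cnj \<alpha>))\<close> the two
  conjugations cancel on \<alpha> and only \<open>z\<close> becomes \<open>cnj z\<close>, so that
  \<open>exp (z * \<mu>)\<close> is replaced by its real or imaginary part under an unchanged
  kernel.\<close>

abbreviation lborel_on :: "real set \<Rightarrow> real measure" where
  "lborel_on A \<equiv> restrict_space lborel A"

text \<open>Series and iterated integrals are handled with Bochner integrals over the restricted
  Borel measure, while the theorem speaks of gauge integrals; this is the bridge.\<close>

lemma
  fixes f :: "real \<Rightarrow> complex"
  assumes "integrable (lborel_on A) f" "A \<in> sets borel"
  shows lborel_on_absolutely_integrable: "f absolutely_integrable_on A"
    and integral_eq_integral_lborel_on: "integral A f = integral\<^sup>L (lborel_on A) f"
proof -
  have *: "set_integrable lborel A f"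
    using assms by (simp add: integrable_restrict_space set_integrable_def)
  show "f absolutely_integrable_on A"
    using * assms(2) unfolding set_integrable_def
    by (subst integrable_completion) auto
  show "integral A f = integral\<^sup>L (lborel_on A) f"
    using set_borel_integral_eq_integral(2)[OF *] assms(2)
    by (simp add: integral_restrict_space set_lebesgue_integral_def)
qed

lemma sigma_finite_lborel_on:
  "A \<in> sets borel \<Longrightarrow> sigma_finite_measure (lborel_on A)"
  by (intro sigma_finite_measure_restrict_space lborel.sigma_finite_measure_axioms) auto

lemma integrable_lborel_on_bound:
  fixes f :: "real \<Rightarrow> complex" and g :: "real \<Rightarrow> real"
  assumes "integrable (lborel_on A) g" "f \<in> borel_measurable borel"
    and "\<And>x. x \<in> A \<Longrightarrow> norm (f x) \<le> g x"
  shows "integrable (lborel_on A) f"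
proof (rule Bochner_Integration.integrable_bound[OF assms(1)])
  show "f \<in> borel_measurable (lborel_on A)"
    using assms(2) by (intro measurable_restrict_space1) auto
  show "AE x in lborel_on A. norm (f x) \<le> norm (g x)"
    using assms(3) by (intro AE_I2) (force simp: space_restrict_space)
qed

lemma integrable_lborel_on_continuous:
  fixes f :: "real \<Rightarrow> 'a::euclidean_space"
  assumes "continuous_on {a..b} f"
  shows "integrable (lborel_on {a..b}) f"
  using borel_integrable_atLeastAtMost'[OF assms]
  by (simp add: integrable_restrict_space set_integrable_def)

section \<open>Double exponential decay on the half-line\<close>

text \<open>Bound \<open>exp x\<close> below by half the square of \<open>x\<close> and complete the
  square. Using \<open>b + 1\<close> in place of \<open>b\<close> leaves the factor
  \<open>exp (- x)\<close>, which gives both integrability and vanishing at infinity.\<close>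

lemma double_exp_le:
  fixes a b x :: real
  assumes "a > 0" "x \<ge> 0"
  shows "exp (- a * exp x + b * x) \<le> exp ((b + 1)\<^sup>2 / (2 * a)) * exp (- x)"
proof -
  have "x\<^sup>2 / 2 \<le> exp x"
    using exp_lower_Taylor_quadratic[of x] assms by simp
  then have "a * (x\<^sup>2 / 2) \<le> a * exp x"
    using assms by (intro mult_left_mono) auto
  moreover have "(b + 1) * x - a * (x\<^sup>2 / 2) \<le> (b + 1)\<^sup>2 / (2 * a)"
  proof -
    have "(b + 1)\<^sup>2 / (2 * a) - ((b + 1) * x - a * (x\<^sup>2 / 2)) = (b + 1 - a * x)\<^sup>2 / (2 * a)"
      using assms by (simp add: field_simps power2_eq_square)
    moreover have "\<dots> \<ge> 0" using assms by simp
    ultimately show ?thesis by linarith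
  qed
  ultimately have "- a * exp x + b * x \<le> (b + 1)\<^sup>2 / (2 * a) + - x"
    by (simp add: algebra_simps)
  then show ?thesis
    by (simp flip: exp_add)
qed

lemma borel_measurable_lborel_on_continuous:
  fixes f :: "real \<Rightarrow> complex"
  assumes "continuous_on UNIV f"
  shows "f \<in> borel_measurable (lborel_on A)"
  using borel_measurable_continuous_onI[OF assms] by (intro measurable_restrict_space1) simp

lemma integrable_double_exp:
  fixes a b :: real
  assumes "a > 0"
  shows "integrable (lborel_on {0<..}) (\<lambda>x. exp (- a * exp x + b * x))"
proof -
  have "((\<lambda>x::real. exp (- 1 * x)) has_integral exp (- 1 * 0) / 1) {0..}"
    by (rule has_integral_exp_minus_to_infinity) simp
  then have "(\<lambda>x::real. exp (- x)) integrable_on {0..}"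
    by (auto simp: has_integral_iff)
  then have "(\<lambda>x::real. exp (- x)) absolutely_integrable_on {0..}"
    by (rule nonnegative_absolutely_integrable_1) simp
  then have "set_integrable lebesgue {0<..} (\<lambda>x::real. exp (- x))"
    by (rule set_integrable_subset) auto
  then have "set_integrable lborel {0<..} (\<lambda>x::real. exp (- x))"
    unfolding set_integrable_def by (subst (asm) integrable_completion) auto
  then have 1: "integrable (lborel_on {0<..}) (\<lambda>x::real. exp (- x))"
    by (simp add: integrable_restrict_space set_integrable_def)
  define C where "C = exp ((b + 1)\<^sup>2 / (2 * a))"
  show ?thesis
  proof (rule Bochner_Integration.integrable_bound[OF integrable_mult_right[OF 1, of C]])
    show "AE x in lborel_on {0<..}. norm (exp (- a * exp x + b * x)) \<le> norm (C * exp (- x))"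
      using double_exp_le[OF assms, of _ b] by (intro AE_I2) (auto simp: C_def space_restrict_space)
  qed (intro measurable_restrict_space1, measurable)
qed

section \<open>Exchanging integrals with derivatives, series and integrals\<close>

text \<open>On the ray \<open>E\<close> is unbounded, so domination has to be assumed: the factor
  with \<delta> absorbs the increments \<open>h\<close> with \<open>norm h < \<delta>\<close>, and
  the square of \<open>norm (E x)\<close> comes from the second-order remainder.\<close>

lemma integrable_exp_param_deriv:
  fixes k E :: "'a \<Rightarrow> complex"
  assumes [measurable]: "k \<in> borel_measurable M" "E \<in> borel_measurable M"
    and int0: "integrable M (\<lambda>x. k x * exp (r * E x))"
    and int1: "integrable M (\<lambda>x. k x * E x * exp (r * E x))"
    and int2: "integrable M (\<lambda>x. norm (k x * exp (r * E x)) * (norm (E x))\<^sup>2 * exp (\<delta> * norm (E x)))"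
    and "\<delta> > 0"
  shows "((\<lambda>r. \<integral>x. k x * exp (r * E x) \<partial>M) has_field_derivative
           (\<integral>x. k x * E x * exp (r * E x) \<partial>M)) (at r)"
proof -
  define F where "F = (\<lambda>r. \<integral>x. k x * exp (r * E x) \<partial>M)"
  define D where "D = (\<integral>x. k x * E x * exp (r * E x) \<partial>M)"
  define B where "B = (\<lambda>x. norm (k x * exp (r * E x)) * (norm (E x))\<^sup>2 * exp (\<delta> * norm (E x)))"
  define C where "C = integral\<^sup>L M B"
  have quot: "norm ((F (r + h) - F r) / h - D) \<le> norm h * C" if h: "h \<noteq> 0" "norm h < \<delta>" for h
  proof -
    \<comment> \<open>The second-order Taylor remainder makes the error of the difference quotient \<open>O(|h|)\<close>.\<close>
    define e where "e = (\<lambda>x. k x * exp (r * E x) * (exp (h * E x) - 1 - h * E x))"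
    have e_bd: "norm (e x) \<le> (norm h)\<^sup>2 * B x" for x
    proof -
      have "norm (exp (h * E x) - (\<Sum>i\<le>1. (h * E x) ^ i / fact i))
              \<le> exp (norm (h * E x)) * norm (h * E x) ^ Suc 1 / fact 1"
        by (rule Taylor_exp_field)
      then have "norm (exp (h * E x) - 1 - h * E x) \<le> exp (norm h * norm (E x)) * (norm h * norm (E x))\<^sup>2"
        by (simp add: norm_mult diff_diff_eq power2_eq_square)
      also have "\<dots> \<le> exp (\<delta> * norm (E x)) * (norm h * norm (E x))\<^sup>2"
        using h by (intro mult_right_mono) (auto intro: mult_right_mono)
      finally have "norm (e x) \<le> norm (k x * exp (r * E x)) * (exp (\<delta> * norm (E x)) * (norm h * norm (E x))\<^sup>2)"
        unfolding e_def norm_mult[of "k x * exp (r * E x)"] by (rule mult_left_mono) simp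
      then show ?thesis
        by (simp add: B_def power_mult_distrib mult_ac)
    qed
    have int_B: "integrable M (\<lambda>x. (norm h)\<^sup>2 * B x)"
      using int2 unfolding B_def by (rule integrable_mult_right)
    have int_e: "integrable M e"
    proof (rule Bochner_Integration.integrable_bound[OF int_B])
      show "AE x in M. norm (e x) \<le> norm ((norm h)\<^sup>2 * B x)"
        unfolding real_norm_def using e_bd by (intro AE_I2) (rule order_trans[OF _ abs_ge_self])
    qed (auto simp: e_def)
    have eq: "k x * exp ((r + h) * E x) = e x + k x * exp (r * E x) + h * (k x * E x * exp (r * E x))" for x
      by (simp add: e_def algebra_simps exp_add)
    have "F (r + h) = integral\<^sup>L M e + F r + h * D"
      unfolding F_def D_def eq using int0 int1 int_e by simp
    then have "(F (r + h) - F r) / h - D = integral\<^sup>L M e / h"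
      using h by (simp add: field_simps)
    moreover have "norm (integral\<^sup>L M e) \<le> (norm h)\<^sup>2 * C"
      using order_trans[OF integral_norm_bound integral_mono[OF integrable_norm[OF int_e] int_B e_bd]]
      by (simp add: C_def)
    ultimately show ?thesis
      using h by (simp add: norm_divide field_simps power2_eq_square)
  qed
  have lim: "((\<lambda>h. norm (h::complex) * C) \<longlongrightarrow> 0) (at 0)"
    by (auto intro!: tendsto_eq_intros)
  have "((\<lambda>h. (F (r + h) - F r) / h - D) \<longlongrightarrow> 0) (at 0)"
  proof (rule Lim_null_comparison[OF _ lim])
    show "\<forall>\<^sub>F h in at 0. norm ((F (r + h) - F r) / h - D) \<le> norm h * C"
      using quot \<open>\<delta> > 0\<close> by (auto simp: eventually_at intro!: exI[of _ \<delta>])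
  qed
  then have "((\<lambda>h. (F (r + h) - F r) / h) \<longlongrightarrow> D) (at 0)"
    by (simp add: LIM_zero_iff)
  then show ?thesis
    unfolding DERIV_def F_def D_def .
qed

text \<open>Expand \<open>exp (r * B x)\<close>. Since \<open>B\<close> is bounded by 1, the norms
  of the terms have integrals dominated by the series of \<open>exp (norm r)\<close> times the
  integral of \<open>norm (K x)\<close>. Applied to Hankel's integrands, the power of
  \<open>B\<close> raises \<open>s\<close> to \<open>s + k\<close>.\<close>

lemma sums_integral_mult_exp:
  fixes K B :: "'a \<Rightarrow> complex"
  assumes K: "integrable M K" and [measurable]: "B \<in> borel_measurable M"
    and B: "\<And>x. x \<in> space M \<Longrightarrow> norm (B x) \<le> 1"
  shows "(\<lambda>k. r ^ k / fact k * (\<integral>x. K x * B x ^ k \<partial>M)) sums (\<integral>x. K x * exp (r * B x) \<partial>M)"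
proof -
  have [measurable]: "K \<in> borel_measurable M" using K by auto
  have bd: "norm (K x * B x ^ k) \<le> norm (K x)" if "x \<in> space M" for x k
    using B[OF that] by (simp add: norm_mult norm_power mult_left_le power_le_one)
  have int: "integrable M (\<lambda>x. K x * B x ^ k)" for k
    by (rule Bochner_Integration.integrable_bound[OF K]) (auto intro!: AE_I2 bd)
  define f where "f = (\<lambda>k x. (r ^ k / fact k) * (K x * B x ^ k))"
  have int_f: "integrable M (f k)" for k
    unfolding f_def by (rule integrable_mult_right[OF int])
  have sums_f: "(\<lambda>k. f k x) sums (K x * exp (r * B x))" for x
  proof -
    have "(\<lambda>k. K x * ((r * B x) ^ k /\<^sub>R fact k)) sums (K x * exp (r * B x))"
      by (intro sums_mult exp_converges)
    then show ?thesis
      by (simp add: f_def scaleR_conv_of_real field_simps power_mult_distrib)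
  qed
  have "(\<lambda>k. integral\<^sup>L M (f k)) sums (\<integral>x. (\<Sum>k. f k x) \<partial>M)"
  proof (rule sums_integral[OF int_f])
    show "AE x in M. summable (\<lambda>k. norm (f k x))"
    proof (rule AE_I2)
      fix x
      have "summable (\<lambda>k. norm (K x) * (norm (r * B x) ^ k /\<^sub>R fact k))"
        by (intro summable_mult summable_exp_generic)
      then show "summable (\<lambda>k. norm (f k x))"
        by (simp add: f_def norm_mult norm_divide norm_power field_simps power_mult_distrib)
    qed
    show "summable (\<lambda>k. \<integral>x. norm (f k x) \<partial>M)"
    proof (rule summable_comparison_test')
      show "summable (\<lambda>k. (norm r ^ k /\<^sub>R fact k) * (\<integral>x. norm (K x) \<partial>M))"
        by (intro summable_mult2 summable_exp_generic)
      fix k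
      have "(\<integral>x. norm (f k x) \<partial>M) = norm r ^ k / fact k * (\<integral>x. norm (K x * B x ^ k) \<partial>M)"
        unfolding f_def norm_mult[of "r ^ k / fact k"]
        by (simp add: norm_divide norm_power)
      also have "\<dots> \<le> norm r ^ k / fact k * (\<integral>x. norm (K x) \<partial>M)"
        using int K bd by (intro mult_left_mono integral_mono) auto
      finally show "norm (\<integral>x. norm (f k x) \<partial>M) \<le> (norm r ^ k /\<^sub>R fact k) * (\<integral>x. norm (K x) \<partial>M)"
        by (simp add: divide_inverse mult_ac)
    qed
  qed
  moreover have "(\<Sum>k. f k x) = K x * exp (r * B x)" for x
    using sums_f by (rule sums_unique[symmetric])
  ultimately show ?thesis
    by (simp add: f_def)
qed

text \<open>The product \<open>w x * K y\<close> dominates the integrand. The weight will carry the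
  endpoint singularity of the fractional kernel, and \<open>K\<close> a bound on Schlaefli's
  integrand that is uniform in the order.\<close>

lemma fubini_weighted:
  fixes w :: "'a \<Rightarrow> complex" and K :: "'b \<Rightarrow> real" and c :: "'a \<Rightarrow> 'b \<Rightarrow> complex"
  assumes "sigma_finite_measure M" "sigma_finite_measure N"
    and w: "integrable M w" and K: "integrable N K"
    and c: "(\<lambda>(x, y). c x y) \<in> borel_measurable (M \<Otimes>\<^sub>M N)"
    and bd: "\<And>x y. x \<in> space M \<Longrightarrow> y \<in> space N \<Longrightarrow> norm (c x y) \<le> K y"
  shows "integrable M (\<lambda>x. w x * (\<integral>y. c x y \<partial>N))"
    and "integrable N (\<lambda>y. \<integral>x. w x * c x y \<partial>M)"
    and "(\<integral>x. w x * (\<integral>y. c x y \<partial>N) \<partial>M) = (\<integral>y. (\<integral>x. w x * c x y \<partial>M) \<partial>N)"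
proof -
  interpret pair_sigma_finite M N
    using assms(1,2) by (simp add: pair_sigma_finite_def)
  have [measurable]: "w \<in> borel_measurable M" "K \<in> borel_measurable N" using w K by auto
  note [measurable] = c
  have cy: "integrable N (\<lambda>y. c x y)" if "x \<in> space M" for x
  proof (rule Bochner_Integration.integrable_bound[OF K])
    show "(\<lambda>y. c x y) \<in> borel_measurable N"
      using measurable_compose[OF measurable_Pair1'[OF that] c] by simp
    show "AE y in N. norm (c x y) \<le> norm (K y)"
      using bd[OF that] by (intro AE_I2) force
  qed
  have int: "integrable (M \<Otimes>\<^sub>M N) (\<lambda>(x, y). w x * c x y)"
  proof (rule Fubini_integrable)
    show "(\<lambda>(x, y). w x * c x y) \<in> borel_measurable (M \<Otimes>\<^sub>M N)" by measurable
    show "AE x in M. integrable N (\<lambda>y. case (x, y) of (x, y) \<Rightarrow> w x * c x y)"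
      using cy by (intro AE_I2) simp
    show "integrable M (\<lambda>x. \<integral>y. norm (case (x, y) of (x, y) \<Rightarrow> w x * c x y) \<partial>N)"
    proof (rule Bochner_Integration.integrable_bound[OF integrable_mult_left[OF w, of "of_real (integral\<^sup>L N K)"]])
      show "AE x in M. norm (\<integral>y. norm (case (x, y) of (x, y) \<Rightarrow> w x * c x y) \<partial>N)
              \<le> norm (w x * of_real (integral\<^sup>L N K))"
      proof (rule AE_I2)
        fix x assume x: "x \<in> space M"
        have "(\<integral>y. norm (w x * c x y) \<partial>N) = norm (w x) * (\<integral>y. norm (c x y) \<partial>N)"
          by (simp add: norm_mult)
        also have "\<dots> \<le> norm (w x) * integral\<^sup>L N K"
          using cy[OF x] K bd[OF x] by (intro mult_left_mono integral_mono) auto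
        also have "\<dots> \<le> norm (w x) * \<bar>integral\<^sup>L N K\<bar>"
          by (intro mult_left_mono) auto
        finally show "norm (\<integral>y. norm (case (x, y) of (x, y) \<Rightarrow> w x * c x y) \<partial>N)
              \<le> norm (w x * of_real (integral\<^sup>L N K))"
          by (simp add: norm_mult)
      qed
    qed measurable
  qed
  have eq: "(\<integral>y. w x * c x y \<partial>N) = w x * (\<integral>y. c x y \<partial>N)" for x
    by simp
  show "integrable M (\<lambda>x. w x * (\<integral>y. c x y \<partial>N))"
    using integrable_fst[OF int] by (simp add: eq)
  show "integrable N (\<lambda>y. \<integral>x. w x * c x y \<partial>M)"
    using integrable_snd[OF int] .
  show "(\<integral>x. w x * (\<integral>y. c x y \<partial>N) \<partial>M) = (\<integral>y. (\<integral>x. w x * c x y \<partial>M) \<partial>N)"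
    using Fubini_integral[OF int] by (simp add: eq)
qed

section \<open>Hankel's integral for the reciprocal gamma function\<close>

text \<open>The integral of \<open>e\<^sup>u u\<^sup>-\<^sup>s\<^sup>-\<^sup>1\<close> along the two parts of Hankel's contour, \<open>u = r e\<^sup>i\<^sup>x\<close> and
  \<open>u = - r e\<^sup>x\<close>, multiplied by \<open>r\<^sup>s\<close>. The two sides of the ray combine to the factor
  \<open>sin (\<pi> s)\<close> in \<open>hankel\<close>.\<close>

definition hankel_circle :: "real \<Rightarrow> complex \<Rightarrow> complex" where
  "hankel_circle s r =
     (\<integral>x. exp (- \<i> * of_real s * of_real x) * exp (r * exp (\<i> * of_real x)) \<partial>lborel_on {-pi..pi})"

definition hankel_ray :: "real \<Rightarrow> complex \<Rightarrow> complex" where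
  "hankel_ray s r =
     (\<integral>x. exp (- of_real s * of_real x) * exp (r * - exp (of_real x)) \<partial>lborel_on {0<..})"

definition hankel :: "real \<Rightarrow> complex \<Rightarrow> complex" where
  "hankel s r = hankel_circle s r / (2 * of_real pi) -
     of_real (sin (pi * s)) / of_real pi * hankel_ray s r"

section \<open>Derivatives of the Hankel integrals in r\<close>

lemma continuous_hankel_circle_integrand:
  "continuous_on A (\<lambda>x::real. exp (- \<i> * of_real s * of_real x) * exp (r * exp (\<i> * of_real x)))"
  by (intro continuous_intros)

lemma integrable_hankel_circle:
  "integrable (lborel_on {-pi..pi})
     (\<lambda>x. exp (- \<i> * of_real s * of_real x) * exp (r * exp (\<i> * of_real x)))"
  by (intro integrable_lborel_on_continuous continuous_hankel_circle_integrand)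

lemma norm_hankel_ray_integrand:
  "norm (exp (- of_real s * of_real x) * exp (r * - exp (of_real x))) = exp (- Re r * exp x + (- s) * x)"
  by (simp add: norm_mult Im_exp Re_exp flip: exp_add)

lemma integrable_hankel_ray:
  assumes "Re r > 0"
  shows "integrable (lborel_on {0<..})
     (\<lambda>x. exp (- of_real s * of_real x) * exp (r * - exp (of_real x)))"
proof (rule integrable_lborel_on_bound[OF integrable_double_exp[OF assms, of "- s"]])
  show "(\<lambda>x::real. exp (- of_real s * of_real x) * exp (r * - exp (of_real x))) \<in> borel_measurable borel"
    by (intro borel_measurable_continuous_onI continuous_intros)
qed (subst norm_hankel_ray_integrand, simp)

lemma has_field_derivative_hankel_circle:
  "(hankel_circle s has_field_derivative hankel_circle (s - 1) r) (at r)"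
proof -
  have eq: "exp (- \<i> * of_real s * of_real x) * exp (\<i> * of_real x) * exp (r * exp (\<i> * of_real x))
     = exp (- \<i> * of_real (s - 1) * of_real x) * exp (r * exp (\<i> * of_real x))" for x :: real
    by (simp add: algebra_simps flip: exp_add)
  have "((\<lambda>r. \<integral>x. exp (- \<i> * of_real s * of_real x) * exp (r * exp (\<i> * of_real x)) \<partial>lborel_on {-pi..pi})
      has_field_derivative (\<integral>x. exp (- \<i> * of_real s * of_real x) * exp (\<i> * of_real x) *
        exp (r * exp (\<i> * of_real x)) \<partial>lborel_on {-pi..pi})) (at r)"
  proof (rule integrable_exp_param_deriv[where \<delta> = 1])
    show "(\<lambda>x. exp (- \<i> * of_real s * of_real x)) \<in> borel_measurable (lborel_on {-pi..pi})"
      "(\<lambda>x. exp (\<i> * of_real x)) \<in> borel_measurable (lborel_on {-pi..pi})"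
      by (auto intro!: borel_measurable_lborel_on_continuous continuous_intros)
  qed (intro integrable_lborel_on_continuous continuous_intros | simp)+
  then show ?thesis
    unfolding hankel_circle_def eq .
qed

lemma has_field_derivative_hankel_ray:
  assumes "Re r > 0"
  shows "(hankel_ray s has_field_derivative - hankel_ray (s - 1) r) (at r)"
proof -
  have eq: "exp (- of_real s * of_real x) * - exp (of_real x) * exp (r * - exp (of_real x))
     = - (exp (- of_real (s - 1) * of_real x) * exp (r * - exp (of_real x)) :: complex)" for x :: real
    by (simp add: algebra_simps flip: exp_add)
  have "((\<lambda>r. \<integral>x. exp (- of_real s * of_real x) * exp (r * - exp (of_real x)) \<partial>lborel_on {0<..})
      has_field_derivative (\<integral>x. exp (- of_real s * of_real x) * - exp (of_real x) *
        exp (r * - exp (of_real x)) \<partial>lborel_on {0<..})) (at r)"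
  \<comment> \<open>Half of the decay \<open>exp (- Re r * exp x)\<close> is spent on the factor
    with \<delta>, the other half remains. The squared norm of \<open>exp x\<close> then changes the
    linear exponent from \<open>- s\<close> to \<open>2 - s\<close>.\<close>
  proof (rule integrable_exp_param_deriv[where \<delta> = "Re r / 2"])
    show "(\<lambda>x. exp (- of_real s * of_real x) :: complex) \<in> borel_measurable (lborel_on {0<..})"
      "(\<lambda>x. - exp (of_real x) :: complex) \<in> borel_measurable (lborel_on {0<..})"
      by (auto intro!: borel_measurable_lborel_on_continuous continuous_intros)
    show "integrable (lborel_on {0<..})
        (\<lambda>x. exp (- of_real s * of_real x) * - exp (of_real x) * exp (r * - exp (of_real x)))"
      unfolding eq using integrable_hankel_ray[OF assms] by (rule integrable_minus)
    have *: "norm (exp (- of_real s * of_real x) * exp (r * - exp (of_real x))) *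
        (norm (- exp (of_real x) :: complex))\<^sup>2 * exp (Re r / 2 * norm (- exp (of_real x) :: complex))
        = exp (- (Re r / 2) * exp x + (2 - s) * x)" for x :: real
      unfolding norm_hankel_ray_integrand
      by (simp add: power2_eq_square algebra_simps flip: exp_add)
    show "integrable (lborel_on {0<..}) (\<lambda>x. norm (exp (- of_real s * of_real x) * exp (r * - exp (of_real x))) *
        (norm (- exp (of_real x) :: complex))\<^sup>2 * exp (Re r / 2 * norm (- exp (of_real x) :: complex)))"
      unfolding * using assms by (intro integrable_double_exp) simp
  qed (use assms integrable_hankel_ray[OF assms] in auto)
  then show ?thesis
    unfolding hankel_ray_def eq by simp
qed

section \<open>Recurrences in s by integration by parts\<close>

text \<open>The difference of the integrands is the derivative of \<open>\<i> * G s x\<close>. At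
  \<open>x = \<pi>\<close> and \<open>x = - \<pi>\<close> the contour point is
  \<open>u = - r\<close>, approached with opposite arguments; this produces \<open>exp (- r)\<close>
  and the sine.\<close>

lemma hankel_circle_recurrence:
  "of_real s * hankel_circle s r = 2 * exp (- r) * of_real (sin (pi * s)) + r * hankel_circle (s - 1) r"
proof -
  define G where "G = (\<lambda>s (x::real). exp (- \<i> * of_real s * of_real x) * exp (r * exp (\<i> * of_real x)))"
  define F where "F = (\<lambda>x::real. \<i> * G s x)"
  have eq: "exp (\<i> * of_real x) * G s x = G (s - 1) x" for x
    by (simp add: G_def algebra_simps flip: exp_add)
  have "((\<lambda>x. of_real s * G s x - r * G (s - 1) x) has_integral F pi - F (- pi)) {-pi..pi}"
  proof (rule fundamental_theorem_of_calculus)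
    fix x :: real
    have "((\<lambda>z. \<i> * (exp (- \<i> * of_real s * z) * exp (r * exp (\<i> * z)))) has_field_derivative
        of_real s * G s x - r * G (s - 1) x) (at (of_real x))"
      unfolding eq[symmetric]
      by (auto intro!: derivative_eq_intros simp: G_def algebra_simps)
    from has_vector_derivative_real_field[OF this]
    show "(F has_vector_derivative of_real s * G s x - r * G (s - 1) x) (at x within {-pi..pi})"
      unfolding F_def G_def by (rule has_vector_derivative_at_within)
  qed simp
  moreover have "F pi - F (- pi) = 2 * exp (- r) * of_real (sin (pi * s))"
    by (simp add: F_def G_def sin_exp_eq exp_minus field_simps flip: sin_of_real)
  moreover have "((\<lambda>x. of_real s * G s x - r * G (s - 1) x) has_integral
      of_real s * hankel_circle s r - r * hankel_circle (s - 1) r) {-pi..pi}"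
  proof -
    have *: "(G s has_integral hankel_circle s r) {-pi..pi}" for s
      using lborel_on_absolutely_integrable[OF integrable_hankel_circle[of s r]]
        integral_eq_integral_lborel_on[OF integrable_hankel_circle[of s r]]
      by (auto simp: G_def hankel_circle_def has_integral_iff absolutely_integrable_on_def)
    show ?thesis
      by (intro has_integral_diff has_integral_mult_right *)
  qed
  ultimately show ?thesis
    by (metis (no_types, lifting) diff_eq_eq has_integral_unique)
qed

text \<open>Here the antiderivative is \<open>- G s x\<close>, which vanishes at infinity. The
  remaining boundary term again belongs to \<open>u = - r\<close>, where the ray begins.\<close>

lemma hankel_ray_recurrence:
  assumes "Re r > 0"
  shows "of_real s * hankel_ray s r = exp (- r) - r * hankel_ray (s - 1) r"
proof -
  define G where "G = (\<lambda>s (x::real). exp (- of_real s * of_real x) * exp (r * - exp (of_real x)))"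
  have eq: "exp (of_real x) * G s x = G (s - 1) x" for x
    by (simp add: G_def algebra_simps flip: exp_add)
  have int: "set_integrable lborel {0<..} (G s)" for s
    using integrable_hankel_ray[OF assms, of s]
    by (simp add: G_def integrable_restrict_space set_integrable_def)
  have ray: "(LINT x:{0<..}|lborel. G s x) = hankel_ray s r" for s
    by (simp add: G_def hankel_ray_def integral_restrict_space set_lebesgue_integral_def)
  have "(LBINT x=ereal 0..\<infinity>. of_real s * G s x + r * G (s - 1) x) = 0 - (- exp (- r))"
  proof (rule interval_integral_FTC_integrable)
    fix x :: real
    have "((\<lambda>z. - (exp (- of_real s * z) * exp (r * - exp z))) has_field_derivative
        of_real s * G s x + r * G (s - 1) x) (at (of_real x))"
      unfolding eq[symmetric]
      by (auto intro!: derivative_eq_intros simp: G_def algebra_simps)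
    from has_vector_derivative_real_field[OF this]
    show "((\<lambda>x. - G s x) has_vector_derivative of_real s * G s x + r * G (s - 1) x) (at x)"
      unfolding G_def .
    show "isCont (\<lambda>x. of_real s * G s x + r * G (s - 1) x) x"
      unfolding G_def by (intro continuous_intros)
  next
    show "set_integrable lborel (einterval (ereal 0) \<infinity>) (\<lambda>x. of_real s * G s x + r * G (s - 1) x)"
      using int by (simp add: einterval_eq)
  next
    have "isCont (\<lambda>x. - G s x) 0"
      unfolding G_def by (intro continuous_intros)
    then have "((\<lambda>x. - G s x) \<longlongrightarrow> - G s 0) (at_right 0)"
      by (simp add: isCont_def filterlim_at_split)
    then show "(((\<lambda>x. - G s x) \<circ> real_of_ereal) \<longlongrightarrow> - exp (- r)) (at_right (ereal 0))"
      unfolding ereal_tendsto_simps by (simp add: G_def)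
  next
    have lim: "((\<lambda>x::real. exp ((- s + 1)\<^sup>2 / (2 * Re r)) * exp (- x)) \<longlongrightarrow> 0) at_top"
      by (intro tendsto_mult_right_zero filterlim_compose[OF exp_at_bot] filterlim_uminus_at_bot_at_top)
    have "((\<lambda>x. - G s x) \<longlongrightarrow> 0) at_top"
    proof (rule Lim_null_comparison[OF _ lim])
      show "\<forall>\<^sub>F x in at_top. norm (- G s x) \<le> exp ((- s + 1)\<^sup>2 / (2 * Re r)) * exp (- x)"
        using eventually_ge_at_top[of 0]
      proof eventually_elim
        case (elim x)
        then show ?case
          unfolding norm_minus_cancel G_def norm_hankel_ray_integrand by (rule double_exp_le[OF assms])
      qed
    qed
    then show "(((\<lambda>x. - G s x) \<circ> real_of_ereal) \<longlongrightarrow> 0) (at_left \<infinity>)"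
      unfolding ereal_tendsto_simps .
  qed simp
  moreover have "(LBINT x=ereal 0..\<infinity>. of_real s * G s x + r * G (s - 1) x)
      = of_real s * hankel_ray s r + r * hankel_ray (s - 1) r"
    unfolding interval_integral_to_infinity_eq using int by (simp add: ray)
  ultimately show ?thesis
    by (simp add: algebra_simps)
qed

text \<open>This sign compensates the minus sign in the derivative and in the recurrence of the ray
  integral, so that \<open>hankel\<close> shifts without sign.\<close>

lemma sin_pi_shift: "sin (pi * (s - 1)) = - sin (pi * s)"
  by (simp add: algebra_simps sin_diff)

text \<open>The boundary terms of circle and ray, both at \<open>u = - r\<close>, cancel: the
  weights in \<open>hankel\<close> turn each into
  \<open>exp (- r) * sin (pi * s) / pi\<close>.\<close>

lemma hankel_recurrence:
  assumes "Re r > 0"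
  shows "of_real s * hankel s r = r * hankel (s - 1) r"
proof -
  have "of_real s * hankel s r = (of_real s * hankel_circle s r) / (2 * of_real pi) -
     of_real (sin (pi * s)) / of_real pi * (of_real s * hankel_ray s r)"
    by (simp add: hankel_def algebra_simps)
  also have "\<dots> = r * hankel (s - 1) r"
    unfolding hankel_circle_recurrence hankel_ray_recurrence[OF assms] hankel_def sin_pi_shift
    by (simp add: field_simps)
  finally show ?thesis .
qed

lemma has_field_derivative_hankel:
  assumes "Re r > 0"
  shows "(hankel s has_field_derivative hankel (s - 1) r) (at r)"
  unfolding hankel_def sin_pi_shift
  by (auto intro!: derivative_eq_intros has_field_derivative_hankel_circle
      has_field_derivative_hankel_ray[OF assms])

section \<open>Power law in r and its constant\<close>

text \<open>Derivative and recurrence make the derivative of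
  \<open>hankel s r * r powr (- s)\<close> vanish. The half-plane is convex and avoids the branch
  cut of the power.\<close>

lemma hankel_eq_const_powr:
  obtains c where "\<And>r. Re r > 0 \<Longrightarrow> hankel s r = c * r powr of_real s"
proof -
  have "\<exists>c. \<forall>r\<in>{r. Re r > 0}. hankel s r * r powr (- of_real s) = c"
  proof (rule has_field_derivative_zero_constant)
    show "convex {r. Re r > 0}" by (rule convex_halfspace_Re_gt)
    fix r assume "r \<in> {r. Re r > 0}"
    then have r: "Re r > 0" "r \<noteq> 0" "r \<notin> \<real>\<^sub>\<le>\<^sub>0"
      by (auto simp: complex_nonpos_Reals_iff)
    have "((\<lambda>r. hankel s r * r powr (- of_real s)) has_field_derivative
        hankel s r * (- of_real s * r powr (- of_real s - 1)) + hankel (s - 1) r * r powr (- of_real s)) (at r)"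
      using r by (intro DERIV_mult' has_field_derivative_hankel has_field_derivative_powr) auto
    moreover have "hankel s r * (- of_real s * r powr (- of_real s - 1)) = - (hankel (s - 1) r * r powr (- of_real s))"
    proof -
      have "hankel s r * (- of_real s * r powr (- of_real s - 1))
          = - (of_real s * hankel s r) * r powr (- of_real s - 1)"
        by simp
      also have "\<dots> = - (r * hankel (s - 1) r) * r powr (- of_real s - 1)"
        by (simp only: hankel_recurrence[OF r(1)])
      also have "\<dots> = - (hankel (s - 1) r * (r * r powr (- of_real s - 1)))"
        by simp
      also have "r * r powr (- of_real s - 1) = r powr (- of_real s)"
        using r by (simp add: powr_diff)
      finally show ?thesis .
    qed
    ultimately show "((\<lambda>r. hankel s r * r powr (- of_real s)) has_field_derivative 0)
        (at r within {r. Re r > 0})"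
      by (auto intro: has_field_derivative_at_within)
  qed
  then obtain c where c: "hankel s r * r powr (- of_real s) = c" if "Re r > 0" for r
    by auto
  show ?thesis
  proof (rule that[of c])
    fix r :: complex assume r: "Re r > 0"
    then have "r powr (- of_real s) * r powr of_real s = 1"
      by (simp flip: powr_add) auto
    then show "hankel s r = c * r powr of_real s"
      using c[OF r] by (metis mult.assoc mult.right_neutral)
  qed
qed

text \<open>With \<open>u = r * exp x\<close> the ray integral times \<open>r powr (- s)\<close>
  becomes the integral of \<open>u powr (- s - 1) * exp (- u)\<close> over \<open>u > r\<close>.
  What it lacks of \<open>Gamma (- s)\<close> is the part over \<open>[0, r]\<close>, at most the
  integral of the power alone, which converges because \<open>s < 0\<close>.\<close>

lemma hankel_ray_gamma_bound:
  fixes r s :: real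
  assumes "s < 0" "r > 0"
  shows "norm (hankel_ray s (of_real r) * of_real (r powr (- s)) - of_real (Gamma (- s)))
           \<le> r powr (- s) / (- s)"
proof -
  define f where "f = (\<lambda>u::real. u powr (- s - 1) / exp u)"
  have f: "(f has_integral Gamma (- s)) {0..}"
    unfolding f_def using Gamma_integral_real[of "- s"] assms by simp
  then have f_abs: "f absolutely_integrable_on {0..}"
    by (intro nonnegative_absolutely_integrable_1) (auto simp: has_integral_iff f_def)
  have f_abs': "f absolutely_integrable_on {r<..}"
    using assms by (intro set_integrable_subset[OF f_abs]) auto
  have f_0r: "f integrable_on {0..r}"
    using set_integrable_subset[OF f_abs, of "{0..r}"] by (auto simp: absolutely_integrable_on_def)
  have disj: "{0..r} \<inter> {r<..} = {}" by auto
  have "integral {0..} f = integral ({0..r} \<union> {r<..}) f"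
    using assms by (intro arg_cong2[of _ _ _ _ integral]) auto
  also have "\<dots> = integral {0..r} f + integral {r<..} f"
    using f_0r f_abs' by (intro integral_Un) (auto simp: absolutely_integrable_on_def disj)
  finally have split: "integral {r<..} f = Gamma (- s) - integral {0..r} f"
    using f by (simp add: integral_unique)
  have "norm (integral {0..r} f) \<le> integral {0..r} (\<lambda>u. u powr (- s - 1))"
  proof (rule Henstock_Kurzweil_Integration.integral_norm_bound_integral[OF f_0r])
    show "(\<lambda>u. u powr (- s - 1)) integrable_on {0..r}"
      using has_integral_powr_from_0[of "- s - 1" r] assms by (auto simp: has_integral_iff)
    show "norm (f u) \<le> u powr (- s - 1)" if "u \<in> {0..r}" for u
      using that by (auto simp: f_def divide_le_eq mult_le_cancel_left1)
  qed
  also have "\<dots> = r powr (- s) / (- s)"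
    using has_integral_powr_from_0[of "- s - 1" r] assms by (simp add: integral_unique)
  finally have bound: "norm (integral {0..r} f) \<le> r powr (- s) / (- s)" .
  have image: "(\<lambda>x. r * exp x) ` {0<..} = {r<..}"
  proof (intro equalityI subsetI)
    fix y assume "y \<in> {r<..}"
    then show "y \<in> (\<lambda>x. r * exp x) ` {0<..}"
      using assms by (intro image_eqI[of _ _ "ln (y / r)"]) (auto simp: field_simps)
  qed (use assms in auto)
  have subst: "\<bar>r * exp x\<bar> * f (r * exp x) = r powr (- s) * (exp (- s * x) * exp (r * - exp x))" for x
    using assms by (simp add: f_def powr_def exp_minus ln_mult field_simps flip: exp_add exp_diff)
  have der: "((\<lambda>x. r * exp x) has_real_derivative r * exp x) (at x within {0<..})" for x
    by (auto intro!: derivative_eq_intros)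
  have inj: "inj_on (\<lambda>x. r * exp x) {0<..}"
    using assms by (auto intro!: inj_onI)
  have "(\<lambda>x. \<bar>r * exp x\<bar> * f (r * exp x)) absolutely_integrable_on {0<..} \<and>
      integral {0<..} (\<lambda>x. \<bar>r * exp x\<bar> * f (r * exp x)) = integral {r<..} f"
    using has_absolute_integral_change_of_variables_1'[OF _ der inj, of f "integral {r<..} f"] f_abs'
    by (simp add: image)
  then have I: "((\<lambda>x. r powr (- s) * (exp (- s * x) * exp (r * - exp x))) has_integral integral {r<..} f) {0<..}"
    unfolding subst by (auto simp: has_integral_iff absolutely_integrable_on_def)
  have ray: "integral {0<..} (\<lambda>x. exp (- of_real s * of_real x) * exp (of_real r * - exp (of_real x))) =
      hankel_ray s (of_real r)"
    unfolding hankel_ray_def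
    using assms by (intro integral_eq_integral_lborel_on integrable_hankel_ray) auto
  have "((\<lambda>x. of_real (r powr (- s)) * (exp (- of_real s * of_real x) * exp (of_real r * - exp (of_real x)))) has_integral
      complex_of_real (integral {r<..} f)) {0<..}"
    using has_integral_of_real[OF I, where ?'b = complex] by (simp flip: exp_of_real)
  then have "of_real (r powr (- s)) * hankel_ray s (of_real r) = complex_of_real (integral {r<..} f)"
    unfolding ray[symmetric] integral_mult_right[symmetric] by (rule integral_unique)
  then have "hankel_ray s (of_real r) * of_real (r powr (- s)) = of_real (Gamma (- s) - integral {0..r} f)"
    unfolding split by (simp only: mult.commute)
  then show ?thesis
    using bound by (simp flip: of_real_mult of_real_diff)
qed

lemma norm_hankel_circle_le:
  "norm (hankel_circle s r) \<le> 2 * pi * exp (norm r)"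
proof -
  have "norm (hankel_circle s r) \<le> (\<integral>x. exp (norm r) \<partial>lborel_on {-pi..pi})"
    unfolding hankel_circle_def
  proof (rule order_trans[OF integral_norm_bound integral_mono])
    show "integrable (lborel_on {-pi..pi}) (\<lambda>x. exp (norm r))"
      by (intro integrable_lborel_on_continuous continuous_intros)
    fix x
    have "Re (r * exp (\<i> * of_real x)) \<le> norm r"
      using complex_Re_le_cmod[of "r * exp (\<i> * of_real x)"] by (simp add: norm_mult)
    then show "norm (exp (- \<i> * of_real s * of_real x) * exp (r * exp (\<i> * of_real x))) \<le> exp (norm r)"
      by (simp add: norm_mult)
  qed (intro integrable_norm integrable_hankel_circle)
  then show ?thesis
    by (simp add: integral_restrict_space measure_restrict_space space_restrict_space)
qed

lemma hankel_eq_neg: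
  assumes "s < 0" "Re r > 0"
  shows "hankel s r = r powr of_real s * rGamma (of_real s + 1)"
proof -
  obtain c where c: "\<And>r. Re r > 0 \<Longrightarrow> hankel s r = c * r powr of_real s"
    using hankel_eq_const_powr by blast
  \<comment> \<open>The limit of \<open>hankel s r * r powr (- s)\<close> as \<open>r\<close> tends
    to 0: the circle part is bounded, so the factor \<open>r powr (- s)\<close> removes it, and the
    ray part contributes \<open>Gamma (- s)\<close>.\<close>
  define d where "d = - of_real (sin (pi * s)) / of_real pi * complex_of_real (Gamma (- s))"
  \<comment> \<open>As \<open>c\<close> does not depend on \<open>r\<close>, real \<open>r\<close>
    suffice. The constant \<open>exp 1\<close> bounds the circle part for \<open>r \<le> 1\<close>,
    and \<open>1 / (- s)\<close> is the error of the ray part, since the sine divided by \<pi> is at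
    most 1 in absolute value.\<close>
  have bound: "norm (c - d) \<le> r powr (- s) * (exp 1 + 1 / (- s))" if r: "0 < r" "r \<le> 1" for r :: real
  proof -
    define a where "a = hankel_ray s (of_real r) * of_real (r powr (- s)) - of_real (Gamma (- s))"
    have "complex_of_real r powr of_real s * of_real (r powr (- s)) = 1"
      using r by (simp add: powr_of_real powr_minus flip: of_real_mult)
    then have "c = hankel s (of_real r) * of_real (r powr (- s))"
      using c[of "of_real r"] r by (simp add: mult.assoc)
    then have "c - d = hankel_circle s (of_real r) / (2 * of_real pi) * of_real (r powr (- s))
        - of_real (sin (pi * s)) / of_real pi * a"
      by (simp add: hankel_def d_def a_def algebra_simps)
    also have "norm \<dots> \<le> exp 1 * r powr (- s) + 1 * (r powr (- s) / (- s))"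
    proof (rule order_trans[OF norm_triangle_ineq4 add_mono])
      have "norm (hankel_circle s (of_real r)) \<le> 2 * pi * exp 1"
        using norm_hankel_circle_le[of s "of_real r"] r
        by (smt (verit) exp_le_cancel_iff mult_left_mono norm_of_real pi_gt_zero)
      then have "norm (hankel_circle s (of_real r) / (2 * of_real pi)) \<le> exp 1"
        by (simp add: norm_divide field_simps)
      then show "norm (hankel_circle s (of_real r) / (2 * of_real pi) * of_real (r powr (- s))) \<le> exp 1 * r powr (- s)"
        unfolding norm_mult by (intro mult_mono) auto
      have "\<bar>sin (pi * s)\<bar> / pi \<le> 1"
        using abs_sin_le_one[of "pi * s"] pi_gt3 by (simp add: field_simps del: abs_sin_le_one)
      then show "norm (of_real (sin (pi * s)) / of_real pi * a) \<le> 1 * (r powr (- s) / (- s))"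
        using hankel_ray_gamma_bound[OF assms(1) r(1)] unfolding norm_mult a_def
        by (intro mult_mono) (auto simp: norm_divide)
    qed
    finally show ?thesis
      by (simp add: algebra_simps)
  qed
  have lim: "((\<lambda>r. r powr (- s) * (exp 1 + 1 / (- s))) \<longlongrightarrow> 0) (at_right 0)"
  proof -
    have "((\<lambda>r::real. r powr (- s)) \<longlongrightarrow> 0 powr (- s)) (at_right 0)"
      using assms by (intro tendsto_powr' tendsto_intros) (auto simp: eventually_at_filter)
    then show ?thesis
      by (auto intro!: tendsto_mult_left_zero)
  qed
  have "\<forall>\<^sub>F r in at_right 0. norm (c - d) \<le> r powr (- s) * (exp 1 + 1 / (- s))"
    using eventually_at_right_real[of 0 "1::real", OF zero_less_one] by eventually_elim (use bound in auto)
  then have "norm (c - d) \<le> 0"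
    by (intro tendsto_lowerbound[OF lim]) auto
  then have "c = d" by simp
  \<comment> \<open>The reflection formula at \<open>- s\<close>; \<open>Gamma (- s)\<close> is
    neither a pole nor zero there because \<open>- s > 0\<close>.\<close>
  moreover have "d = rGamma (of_real s + 1)"
  proof -
    have "complex_of_real (- s) \<notin> \<int>\<^sub>\<le>\<^sub>0"
      using assms by (subst of_real_in_nonpos_Ints_iff) (auto elim!: nonpos_Ints_cases)
    then have "Gamma (complex_of_real (- s)) * rGamma (complex_of_real (- s)) = 1"
      by (simp add: rGamma_inverse_Gamma Gamma_eq_zero_iff)
    moreover have "d = Gamma (complex_of_real (- s)) * (sin (of_real pi * of_real (- s)) / of_real pi)"
      unfolding Gamma_complex_of_real by (simp add: d_def flip: sin_of_real)
    ultimately show ?thesis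
      by (metis (no_types, lifting) rGamma_reflection_complex mult.assoc mult_1 add.commute
          diff_minus_eq_add of_real_minus)
  qed
  ultimately show ?thesis
    using c assms by simp
qed

text \<open>At order 0 the sine removes the ray, and the circle integral is constant on the
  half-plane. Unlike the ray integral it is also continuous at \<open>r = 0\<close>, where its
  integrand is 1, so its value is the length of the interval.\<close>

lemma hankel_0:
  assumes "Re r > 0"
  shows "hankel 0 r = 1"
proof -
  obtain c where c: "\<And>r. Re r > 0 \<Longrightarrow> hankel 0 r = c * r powr of_real 0"
    using hankel_eq_const_powr by blast
  have c': "hankel_circle 0 r = 2 * of_real pi * c" if "Re r > 0" for r
    using c[OF that] that by (auto simp: hankel_def field_simps)
  have "isCont (hankel_circle 0) 0"
    using has_field_derivative_hankel_circle by (rule DERIV_isCont)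
  moreover have "(\<lambda>n. complex_of_real (inverse (real (Suc n)))) \<longlonglongrightarrow> of_real 0"
    by (intro tendsto_of_real LIMSEQ_inverse_real_of_nat)
  ultimately have "(\<lambda>n. hankel_circle 0 (of_real (inverse (real (Suc n))))) \<longlonglongrightarrow> hankel_circle 0 0"
    using isCont_tendsto_compose by fastforce
  moreover have "hankel_circle 0 (of_real (inverse (real (Suc n)))) = 2 * of_real pi * c" for n
    by (rule c') (simp del: of_nat_Suc)
  ultimately have "hankel_circle 0 0 = 2 * of_real pi * c"
    by (simp add: LIMSEQ_const_iff)
  moreover have "hankel_circle 0 0 = 2 * of_real pi"
    by (simp add: hankel_circle_def integral_restrict_space measure_restrict_space space_restrict_space scaleR_conv_of_real)
  ultimately show ?thesis
    using c[OF assms] assms by auto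
qed

lemma hankel_eq:
  assumes r: "Re r > 0"
  shows "hankel s r = r powr of_real s * rGamma (of_real s + 1)"
proof -
  \<comment> \<open>For real \<open>s\<close> the induction runs on an upper bound:
    \<open>s < n + 1\<close> gives \<open>s - 1 < n\<close>, and the recurrence can be divided by
    \<open>s\<close> unless \<open>s = 0\<close>.\<close>
  have "\<forall>s. s < real n \<longrightarrow> hankel s r = r powr of_real s * rGamma (of_real s + 1)" for n
  proof (induction n)
    case 0
    then show ?case using hankel_eq_neg[OF _ r] by simp
  next
    case (Suc n)
    show ?case
    proof (intro allI impI)
      fix s assume s: "s < real (Suc n)"
      show "hankel s r = r powr of_real s * rGamma (of_real s + 1)"
      proof (cases "s = 0")
        case True
        then show ?thesis using hankel_0[OF r] r by auto
      next
        case False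
        have "of_real s * hankel s r = r * (r powr of_real (s - 1) * rGamma (of_real (s - 1) + 1))"
          using Suc s unfolding hankel_recurrence[OF r] by simp
        also have "r * (r powr of_real (s - 1) * rGamma (of_real (s - 1) + 1))
            = r powr of_real s * rGamma (of_real s)"
          using r by (auto simp: powr_diff)
        also have "\<dots> = of_real s * (r powr of_real s * rGamma (of_real s + 1))"
          by (subst rGamma_plus1[symmetric]) (simp add: mult_ac)
        finally show ?thesis using False by simp
      qed
    qed
  qed
  then show ?thesis
    using reals_Archimedean2 by blast
qed

section \<open>Schlaefli's integral\<close>

text \<open>With \<open>r = t / 2\<close> the k-th term of the Bessel series, prefactor included, is
  \<open>r ^ k / fact k * hankel (s + k) r\<close>. Summing over \<open>k\<close> multiplies the
  circle integrand by \<open>exp (r * exp (- \<i> * x))\<close> and the ray integrand by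
  \<open>exp (- r * exp (- x))\<close>, which completes the exponents to \<open>t * cos x\<close>
  and \<open>- t * cosh x\<close>.\<close>

lemma bessel_I_integral:
  assumes t: "Re t > 0"
  shows "bessel_I (of_real s) t = 1 / of_real pi *
    ((\<integral>x. exp (t * cos (of_real x)) * cos (of_real s * of_real x) \<partial>lborel_on {0..pi}) -
     (\<integral>x. exp (- t * cosh (of_real x)) * (exp (- of_real s * of_real x) * of_real (sin (pi * s))) \<partial>lborel_on {0<..}))"
proof -
  define r where "r = t / 2"
  have r: "Re r > 0" using t by (simp add: r_def)
  define C where "C = (\<integral>x. exp (- \<i> * of_real s * of_real x) * exp (r * exp (\<i> * of_real x)) *
      exp (r * exp (- \<i> * of_real x)) \<partial>lborel_on {-pi..pi})"
  define R where "R = (\<integral>x. exp (- of_real s * of_real x) * exp (r * - exp (of_real x)) *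
      exp (r * - exp (- of_real x)) \<partial>lborel_on {0<..})"
  have circle: "(\<lambda>k. r ^ k / fact k * hankel_circle (s + real k) r) sums C"
  proof -
    have eq: "exp (- \<i> * of_real s * of_real x) * exp (r * exp (\<i> * of_real x)) * exp (- \<i> * of_real x) ^ k
       = exp (- \<i> * of_real (s + real k) * of_real x) * exp (r * exp (\<i> * of_real x))" for x k
      by (simp add: algebra_simps flip: exp_add exp_of_nat_mult)
    have "(\<lambda>k. r ^ k / fact k * (\<integral>x. exp (- \<i> * of_real s * of_real x) * exp (r * exp (\<i> * of_real x)) *
        exp (- \<i> * of_real x) ^ k \<partial>lborel_on {-pi..pi})) sums C"
      unfolding C_def
      by (intro sums_integral_mult_exp integrable_hankel_circle borel_measurable_lborel_on_continuous
          continuous_intros) simp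
    then show ?thesis
      unfolding eq hankel_circle_def .
  qed
  \<comment> \<open>The alternating sign is that of \<open>sin (pi * (s + k))\<close>. It is
    absorbed by summing with \<open>B x = - exp (- x)\<close>, still of norm at most 1 for
    \<open>x > 0\<close>.\<close>
  have ray: "(\<lambda>k. r ^ k / fact k * ((- 1) ^ k * hankel_ray (s + real k) r)) sums R"
  proof -
    have eq: "exp (- of_real s * of_real x) * exp (r * - exp (of_real x)) * (- exp (- of_real x)) ^ k
       = (- 1) ^ k * (exp (- of_real (s + real k) * of_real x) * exp (r * - exp (of_real x)))" for x :: real and k
    proof -
      have "(- exp (- of_real x)) ^ k = (- 1) ^ k * exp (of_nat k * - complex_of_real x)"
        by (subst power_minus) (simp only: exp_of_nat_mult)
      then show ?thesis
        by (simp add: algebra_simps flip: exp_add)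
    qed
    have "(\<lambda>k. r ^ k / fact k * (\<integral>x. exp (- of_real s * of_real x) * exp (r * - exp (of_real x)) *
        (- exp (- of_real x)) ^ k \<partial>lborel_on {0<..})) sums R"
      unfolding R_def
      by (intro sums_integral_mult_exp integrable_hankel_ray r borel_measurable_lborel_on_continuous
          continuous_intros) (simp add: space_restrict_space)
    then show ?thesis
      unfolding eq hankel_ray_def by simp
  qed
  have hankel_shift: "hankel (s + real k) r = hankel_circle (s + real k) r / (2 * of_real pi) -
      of_real (sin (pi * s)) / of_real pi * ((- 1) ^ k * hankel_ray (s + real k) r)" for k
  proof -
    have "sin (pi * (s + real k)) = (- 1) ^ k * sin (pi * s)"
      by (simp add: distrib_left sin_add mult.commute[of pi "real k"])
    then show ?thesis
      by (simp add: hankel_def)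
  qed
  have "(\<lambda>k. r ^ k / fact k * hankel_circle (s + real k) r / (2 * of_real pi) -
      of_real (sin (pi * s)) / of_real pi * (r ^ k / fact k * ((- 1) ^ k * hankel_ray (s + real k) r))) sums
      (C / (2 * of_real pi) - of_real (sin (pi * s)) / of_real pi * R)"
    by (intro sums_diff sums_divide sums_mult circle ray)
  also have "(\<lambda>k. r ^ k / fact k * hankel_circle (s + real k) r / (2 * of_real pi) -
      of_real (sin (pi * s)) / of_real pi * (r ^ k / fact k * ((- 1) ^ k * hankel_ray (s + real k) r)))
      = (\<lambda>k. r powr of_real s * ((t / 2) ^ (2 * k) / (fact k * Gamma (of_real s + of_nat k + 1))))"
  proof
    fix k
    have r2: "r ^ k * r ^ k = (t / 2) ^ (2 * k)"
      by (simp add: r_def mult_2 power_add)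
    have "r ^ k / fact k * hankel_circle (s + real k) r / (2 * of_real pi) -
      of_real (sin (pi * s)) / of_real pi * (r ^ k / fact k * ((- 1) ^ k * hankel_ray (s + real k) r))
      = r ^ k / fact k * hankel (s + real k) r"
      unfolding hankel_shift by (simp add: algebra_simps)
    also have "\<dots> = r ^ k / fact k * (r powr of_real s * r ^ k * rGamma (of_real s + of_nat k + 1))"
      unfolding hankel_eq[OF r] using r by (auto simp: powr_add)
    also have "\<dots> = r powr of_real s * ((t / 2) ^ (2 * k) / (fact k * Gamma (of_real s + of_nat k + 1)))"
      unfolding r2[symmetric] by (simp add: rGamma_inverse_Gamma divide_inverse mult_ac)
    finally show "r ^ k / fact k * hankel_circle (s + real k) r / (2 * of_real pi) -
      of_real (sin (pi * s)) / of_real pi * (r ^ k / fact k * ((- 1) ^ k * hankel_ray (s + real k) r))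
      = r powr of_real s * ((t / 2) ^ (2 * k) / (fact k * Gamma (of_real s + of_nat k + 1)))" .
  qed
  finally have "(\<lambda>k. (t / 2) ^ (2 * k) / (fact k * Gamma (of_real s + of_nat k + 1))) sums
      ((C / (2 * of_real pi) - of_real (sin (pi * s)) / of_real pi * R) / r powr of_real s)"
    using r by (intro sums_mult_D[of "r powr of_real s"]) auto
  then have I: "bessel_I (of_real s) t = C / (2 * of_real pi) - of_real (sin (pi * s)) / of_real pi * R"
    using r by (auto simp: bessel_I_def r_def[symmetric] sums_iff)
  \<comment> \<open>Fold \<open>[- \<pi>, 0]\<close> onto \<open>[0, \<pi>]\<close>:
    \<open>exp (t * cos x)\<close> is even, and the two exponentials in \<open>s * x\<close> add up
    to twice the cosine.\<close>
  have "C = 2 * (\<integral>x. exp (t * cos (of_real x)) * cos (of_real s * of_real x) \<partial>lborel_on {0..pi})"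
  proof -
    define g where "g = (\<lambda>x::real. exp (- \<i> * of_real s * of_real x) * exp (r * exp (\<i> * of_real x)) *
      exp (r * exp (- \<i> * of_real x)))"
    define h where "h = (\<lambda>x::real. exp (t * cos (of_real x)) * cos (of_real s * of_real x))"
    have g_cont: "continuous_on A g" for A
      unfolding g_def by (intro continuous_intros)
    have g_int: "g integrable_on {a..b}" for a b
      by (intro integrable_continuous_interval g_cont)
    have "C = integral {-pi..pi} g"
      unfolding C_def g_def
      by (intro integral_eq_integral_lborel_on[symmetric] integrable_lborel_on_continuous continuous_intros) auto
    also have "\<dots> = integral {-pi..0} g + integral {0..pi} g"
      by (intro Henstock_Kurzweil_Integration.integral_combine[symmetric] g_int) auto
    also have "integral {-pi..0} g = integral {0..pi} (\<lambda>x. g (- x))"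
      using Henstock_Kurzweil_Integration.integral_reflect_real[of pi 0 "\<lambda>x. g (- x)"]
      unfolding minus_minus minus_zero .
    also have "\<dots> + integral {0..pi} g = integral {0..pi} (\<lambda>x. g (- x) + g x)"
      using g_cont by (intro integral_add[symmetric] g_int integrable_continuous_interval)
        (auto intro!: continuous_on_compose2[OF g_cont[of UNIV]] continuous_intros)
    also have "(\<lambda>x. g (- x) + g x) = (\<lambda>x. 2 * h x)"
    proof
      fix x :: real
      have "exp (r * exp (\<i> * of_real x)) * exp (r * exp (- \<i> * of_real x)) = exp (t * cos (of_real x))"
        by (simp add: r_def cos_exp_eq field_simps flip: exp_add)
      then show "g (- x) + g x = 2 * h x"
        by (simp add: g_def h_def cos_exp_eq[of "of_real s * of_real x"] algebra_simps)
    qed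
    also have "integral {0..pi} (\<lambda>x. 2 * h x) = 2 * integral {0..pi} h"
      by simp
    also have "integral {0..pi} h = (\<integral>x. h x \<partial>lborel_on {0..pi})"
      unfolding h_def
      by (intro integral_eq_integral_lborel_on integrable_lborel_on_continuous continuous_intros) auto
    finally show ?thesis unfolding h_def .
  qed
  moreover have "of_real (sin (pi * s)) * R = (\<integral>x. exp (- t * cosh (of_real x)) *
      (exp (- of_real s * of_real x) * of_real (sin (pi * s))) \<partial>lborel_on {0<..})"
  proof -
    have "exp (r * - exp (of_real x)) * exp (r * - exp (- of_real x)) = exp (- t * cosh (of_real x))" for x :: real
      by (simp add: r_def cosh_def scaleR_conv_of_real field_simps flip: exp_add)
    then have "exp (- of_real s * of_real x) * exp (r * - exp (of_real x)) * exp (r * - exp (- of_real x))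
        = exp (- of_real s * of_real x) * exp (- t * cosh (of_real x))" for x :: real
      by (metis mult.assoc)
    then have "of_real (sin (pi * s)) * R = of_real (sin (pi * s)) *
        (\<integral>x. exp (- of_real s * of_real x) * exp (- t * cosh (of_real x)) \<partial>lborel_on {0<..})"
      unfolding R_def by (simp only:)
    also have "\<dots> = (\<integral>x. of_real (sin (pi * s)) * (exp (- of_real s * of_real x) *
         exp (- t * cosh (of_real x))) \<partial>lborel_on {0<..})"
      by (rule integral_mult_right_zero[symmetric])
    finally show ?thesis
      by (simp add: mult_ac)
  qed
  moreover have "bessel_I (of_real s) t = 1 / of_real pi * (C / 2 - of_real (sin (pi * s)) * R)"
    unfolding I by (simp add: right_diff_distrib)
  ultimately show ?thesis
    by simp
qed

section \<open>Fractional integrals\<close>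

text \<open>\<open>Gamma a\<close> times the fractional integral of
  \<open>exp (z * \<mu>)\<close>.\<close>

definition frac_exp :: "complex \<Rightarrow> real \<Rightarrow> real \<Rightarrow> complex \<Rightarrow> complex" where
  "frac_exp a \<nu>0 \<nu> z =
     (\<integral>\<mu>. of_real (\<nu> - \<mu>) powr (a - 1) * exp (z * of_real \<mu>) \<partial>lborel_on {\<nu>0..\<nu>})"

lemma of_real_powr_eq:
  "x \<ge> 0 \<Longrightarrow> complex_of_real x powr a = (if x = 0 then 0 else exp (a * of_real (ln x)))"
  by (auto simp: powr_def Ln_of_real)

text \<open>The norm of the kernel is the real power with exponent \<open>Re a - 1\<close>,
  integrable at the endpoint because \<open>Re a > 0\<close>.\<close>

lemma integrable_frac_kernel:
  assumes a: "Re a > 0" and "\<nu>0 \<le> \<nu>"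
  shows "integrable (lborel_on {\<nu>0..\<nu>}) (\<lambda>\<mu>. complex_of_real (\<nu> - \<mu>) powr (a - 1))"
proof -
  have "((\<lambda>x. x powr (Re a - 1)) has_integral ((\<nu> - \<nu>0) powr Re a / Re a)) (cbox 0 (\<nu> - \<nu>0))"
    using has_integral_powr_from_0[of "Re a - 1" "\<nu> - \<nu>0"] assms by simp
  from has_integral_affinity[OF this, of "-1" \<nu>]
  have "((\<lambda>\<mu>. (\<nu> - \<mu>) powr (Re a - 1)) has_integral ((\<nu> - \<nu>0) powr Re a / Re a)) {\<nu>0..\<nu>}"
    using assms(2) by (simp add: image_affinity_atLeastAtMost add.commute)
  then have "(\<lambda>\<mu>. (\<nu> - \<mu>) powr (Re a - 1)) absolutely_integrable_on {\<nu>0..\<nu>}"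
    by (intro nonnegative_absolutely_integrable_1) (auto simp: has_integral_iff)
  then have int: "integrable (lborel_on {\<nu>0..\<nu>}) (\<lambda>\<mu>. (\<nu> - \<mu>) powr (Re a - 1))"
    unfolding set_integrable_def
    by (subst (asm) integrable_completion) (auto simp: integrable_restrict_space)
  \<comment> \<open>In this form measurability is automatic; the value 0 at
    \<open>\<mu> = \<nu>\<close> matches the default \<open>0 powr (a - 1) = 0\<close>.\<close>
  have "integrable (lborel_on {\<nu>0..\<nu>})
      (\<lambda>\<mu>. if \<mu> = \<nu> then 0 else exp ((a - 1) * of_real (ln (\<nu> - \<mu>))))"
  proof (rule integrable_lborel_on_bound[OF int])
    show "norm (if \<mu> = \<nu> then 0 else exp ((a - 1) * of_real (ln (\<nu> - \<mu>)))) \<le> (\<nu> - \<mu>) powr (Re a - 1)"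
      if "\<mu> \<in> {\<nu>0..\<nu>}" for \<mu>
      using that by (auto simp: powr_def)
  qed measurable
  then show ?thesis
    by (rule Bochner_Integration.integrable_cong[OF refl, THEN iffD1, rotated])
      (auto simp: of_real_powr_eq space_restrict_space simp flip: of_real_diff)
qed

lemma integrable_frac_exp:
  assumes "Re a > 0" and "\<nu>0 \<le> \<nu>"
  shows "integrable (lborel_on {\<nu>0..\<nu>}) (\<lambda>\<mu>. of_real (\<nu> - \<mu>) powr (a - 1) * exp (z * of_real \<mu>))"
proof -
  define B where "B = exp (norm z * max \<bar>\<nu>0\<bar> \<bar>\<nu>\<bar>)"
  have [measurable]: "(\<lambda>\<mu>. complex_of_real (\<nu> - \<mu>) powr (a - 1)) \<in> borel_measurable (lborel_on {\<nu>0..\<nu>})"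
    "(\<lambda>\<mu>. exp (z * of_real \<mu>)) \<in> borel_measurable (lborel_on {\<nu>0..\<nu>})"
    using integrable_frac_kernel[OF assms]
    by (auto intro!: borel_measurable_lborel_on_continuous continuous_intros)
  show ?thesis
  proof (rule Bochner_Integration.integrable_bound)
    show "integrable (lborel_on {\<nu>0..\<nu>}) (\<lambda>\<mu>. complex_of_real (\<nu> - \<mu>) powr (a - 1) * of_real B)"
      using integrable_frac_kernel[OF assms] by (rule integrable_mult_left)
    show "AE \<mu> in lborel_on {\<nu>0..\<nu>}. norm (of_real (\<nu> - \<mu>) powr (a - 1) * exp (z * of_real \<mu>))
        \<le> norm (of_real (\<nu> - \<mu>) powr (a - 1) * of_real B)"
    proof (rule AE_I2)
      fix \<mu> assume "\<mu> \<in> space (lborel_on {\<nu>0..\<nu>})"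
      then have "\<bar>\<mu>\<bar> \<le> max \<bar>\<nu>0\<bar> \<bar>\<nu>\<bar>"
        by (auto simp: space_restrict_space)
      then have "norm z * \<bar>\<mu>\<bar> \<le> norm z * max \<bar>\<nu>0\<bar> \<bar>\<nu>\<bar>"
        by (rule mult_left_mono) simp
      moreover have "Re (z * of_real \<mu>) \<le> norm z * \<bar>\<mu>\<bar>"
        using complex_Re_le_cmod[of "z * of_real \<mu>"] by (simp add: norm_mult)
      ultimately have "norm (exp (z * of_real \<mu>)) \<le> B"
        by (simp add: B_def)
      then show "norm (of_real (\<nu> - \<mu>) powr (a - 1) * exp (z * of_real \<mu>))
        \<le> norm (of_real (\<nu> - \<mu>) powr (a - 1) * of_real B)"
        unfolding norm_mult by (intro mult_left_mono) (auto simp: B_def)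
    qed
  qed measurable
qed

text \<open>Substitute \<open>u = z * (\<nu> - \<mu>)\<close>, which runs along the segment of the
  definition. As \<open>\<nu> - \<mu>\<close> is real and nonnegative, the principal power splits
  into that of \<open>\<nu> - \<mu>\<close> and that of \<open>z\<close>, so no branch correction
  arises.\<close>

lemma reg_lower_gamma_eq_frac_exp:
  assumes a: "Re a > 0" and le: "\<nu>0 \<le> \<nu>" and z: "z \<noteq> 0"
  shows "exp (z * of_real \<nu>) * reg_lower_gamma a (z * of_real (\<nu> - \<nu>0))
           = z powr a * frac_exp a \<nu>0 \<nu> z / Gamma a"
proof -
  define d where "d = \<nu> - \<nu>0"
  define f where "f = (\<lambda>\<mu>. complex_of_real (\<nu> - \<mu>) powr (a - 1) * exp (z * of_real \<mu>))"
  have int: "(f has_integral frac_exp a \<nu>0 \<nu> z) {\<nu>0..\<nu>}"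
    using lborel_on_absolutely_integrable[OF integrable_frac_exp[OF a le, of z]]
      integral_eq_integral_lborel_on[OF integrable_frac_exp[OF a le, of z]]
    by (simp add: f_def frac_exp_def has_integral_iff absolutely_integrable_on_def)
  show ?thesis
  \<comment> \<open>The substitution divides by \<open>d\<close>; for \<open>d = 0\<close> both
    sides vanish.\<close>
  proof (cases "d = 0")
    case True
    then have "frac_exp a \<nu>0 \<nu> z = 0"
      using int has_integral_unique[OF has_integral_refl(2)] by (auto simp: d_def)
    then show ?thesis
      using True by (simp add: reg_lower_gamma_def d_def)
  next
    case False
    then have d: "d > 0" using le by (simp add: d_def)
    have "((\<lambda>x. f (- d * x + \<nu>)) has_integral (1 / d) *\<^sub>R frac_exp a \<nu>0 \<nu> z) {0..1}"
    proof -
      have "((\<lambda>x. f ((- d) *\<^sub>R x + \<nu>)) has_integral (1 / \<bar>- d\<bar> ^ DIM(real)) *\<^sub>R frac_exp a \<nu>0 \<nu> z)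
          ((\<lambda>x. (1 / (- d)) *\<^sub>R x + - ((1 / (- d)) *\<^sub>R \<nu>)) ` cbox \<nu>0 \<nu>)"
        using int d by (intro has_integral_affinity) auto
      moreover have "(\<lambda>x. (1 / (- d)) *\<^sub>R x + - ((1 / (- d)) *\<^sub>R \<nu>)) ` cbox \<nu>0 \<nu> = {0..1}"
      proof (intro equalityI subsetI)
        fix y assume "y \<in> {0..1::real}"
        then have "d * y \<le> d" "0 \<le> d * y"
          using d mult_left_le[of y d] by auto
        moreover have "d = \<nu> - \<nu>0" by (rule d_def)
        ultimately have "\<nu> - d * y \<in> cbox \<nu>0 \<nu>"
          unfolding cbox_interval atLeastAtMost_iff by linarith
        then show "y \<in> (\<lambda>x. (1 / (- d)) *\<^sub>R x + - ((1 / (- d)) *\<^sub>R \<nu>)) ` cbox \<nu>0 \<nu>"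
          using d by (intro image_eqI[of _ _ "\<nu> - d * y"]) (simp add: field_simps)
      next
        fix y assume "y \<in> (\<lambda>x. (1 / (- d)) *\<^sub>R x + - ((1 / (- d)) *\<^sub>R \<nu>)) ` cbox \<nu>0 \<nu>"
        then obtain x where x: "x \<in> {\<nu>0..\<nu>}" "y = (\<nu> - x) / d"
          using d by (auto simp: diff_divide_distrib)
        moreover from x have "\<nu> - x \<le> d" by (simp add: d_def)
        ultimately show "y \<in> {0..1}"
          using d by simp
      qed
      ultimately show ?thesis
        using d by simp
    qed
    \<comment> \<open>The prefactor collects \<open>du = z * d * dx\<close>, the factor
      \<open>z powr (a - 1)\<close> of the power, and \<open>exp (- z * \<nu>)\<close>, which turns
      \<open>exp (z * \<mu>)\<close> into \<open>exp (- u)\<close>.\<close>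
    then have "((\<lambda>x. of_real d * z powr a * exp (- z * of_real \<nu>) * f (- d * x + \<nu>)) has_integral
        of_real d * z powr a * exp (- z * of_real \<nu>) * ((1 / d) *\<^sub>R frac_exp a \<nu>0 \<nu> z)) {0..1}"
      by (rule has_integral_mult_right)
    moreover have "of_real d * z powr a * exp (- z * of_real \<nu>) * f (- d * x + \<nu>)
        = (linepath 0 (z * of_real d) x powr (a - 1) * exp (- linepath 0 (z * of_real d) x)) * (z * of_real d - 0)"
      if "x \<in> {0..1}" for x
    proof -
      have "linepath 0 (z * of_real d) x powr (a - 1) = (of_real (d * x) * z) powr (a - 1)"
        by (simp add: linepath_def scaleR_conv_of_real mult_ac)
      also have "\<dots> = of_real (d * x) powr (a - 1) * z powr (a - 1)"
        using that d by (intro powr_times_real_left) auto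
      also have "z powr (a - 1) = z powr a / z"
        using z by (simp add: powr_diff)
      finally have "linepath 0 (z * of_real d) x powr (a - 1) = of_real (d * x) powr (a - 1) * (z powr a / z)" .
      moreover have "exp (- z * of_real \<nu>) * exp (z * of_real (- d * x + \<nu>)) = exp (- linepath 0 (z * of_real d) x)"
        by (simp add: linepath_def scaleR_conv_of_real algebra_simps flip: exp_add)
      ultimately show ?thesis
        using z by (simp add: f_def)
    qed
    ultimately have "((\<lambda>u. u powr (a - 1) * exp (- u)) has_contour_integral
        of_real d * z powr a * exp (- z * of_real \<nu>) * ((1 / d) *\<^sub>R frac_exp a \<nu>0 \<nu> z)) (linepath 0 (z * of_real d))"
      unfolding has_contour_integral_linepath by (subst has_integral_cong[symmetric])
    then have "reg_lower_gamma a (z * of_real d) =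
        1 / Gamma a * (of_real d * z powr a * exp (- z * of_real \<nu>) * ((1 / d) *\<^sub>R frac_exp a \<nu>0 \<nu> z))"
      by (simp add: reg_lower_gamma_def contour_integral_unique)
    then show ?thesis
      using d by (simp add: d_def[symmetric] scaleR_conv_of_real exp_minus)
  qed
qed

section \<open>Continued real and imaginary parts\<close>

text \<open>The kernel has a nonnegative base, so conjugation passes to its exponent and undoes
  \<open>cnj a\<close>; only \<open>z\<close> is left conjugated.\<close>

lemma cnj_frac_exp:
  "cnj (frac_exp (cnj a) \<nu>0 \<nu> z) = frac_exp a \<nu>0 \<nu> (cnj z)"
  unfolding frac_exp_def Bochner_Integration.integral_cnj[symmetric]
proof (rule Bochner_Integration.integral_cong[OF refl])
  fix \<mu> assume "\<mu> \<in> space (lborel_on {\<nu>0..\<nu>})"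
  then have "cnj (of_real (\<nu> - \<mu>) powr (cnj a - 1)) = of_real (\<nu> - \<mu>) powr (a - 1)"
    by (subst cnj_powr) (auto simp: space_restrict_space)
  then show "cnj (of_real (\<nu> - \<mu>) powr (cnj a - 1) * exp (z * of_real \<mu>))
      = of_real (\<nu> - \<mu>) powr (a - 1) * exp (cnj z * of_real \<mu>)"
    by (simp add: exp_cnj)
qed

text \<open>The phase \<open>exp (- \<i> * \<pi> * a / 2)\<close> cancels \<open>\<i> powr a\<close>
  in \<open>(\<i> * x) powr a\<close>. The factor \<open>x powr a / Gamma a\<close> that remains is
  unchanged by conjugating both \<open>a\<close> and the result, so averaging affects only the
  exponentials and yields the cosine.\<close>

lemma Re_cont_frac_exp:
  assumes a: "Re \<alpha> > 0" and le: "\<nu>0 \<le> \<nu>" and x: "x > 0"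
  shows "Re_cont (\<lambda>a. exp (\<i> * (of_real (\<nu> * x) - of_real pi * a / 2)) *
            reg_lower_gamma a (\<i> * of_real x * of_real (\<nu> - \<nu>0))) \<alpha>
    = of_real x powr \<alpha> / Gamma \<alpha> *
        (\<integral>\<mu>. of_real (\<nu> - \<mu>) powr (\<alpha> - 1) * cos (of_real \<mu> * of_real x) \<partial>lborel_on {\<nu>0..\<nu>})"
proof -
  define F where "F = (\<lambda>a. exp (\<i> * (of_real (\<nu> * x) - of_real pi * a / 2)) *
            reg_lower_gamma a (\<i> * of_real x * of_real (\<nu> - \<nu>0)))"
  have F: "F a = of_real x powr a / Gamma a * frac_exp a \<nu>0 \<nu> (\<i> * of_real x)" if "Re a > 0" for a
  proof -
    have expo: "\<i> * (of_real (\<nu> * x) - of_real pi * a / 2)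
        = - (\<i> * (of_real pi * a / 2)) + \<i> * of_real x * of_real \<nu>"
      by (simp add: algebra_simps)
    have "(of_real x * \<i>) powr a = of_real x powr a * \<i> powr a"
      using x by (intro powr_times_real_left) auto
    also have "\<i> powr a = exp (\<i> * (of_real pi * a / 2))"
      by (simp add: powr_def mult_ac)
    finally have phase: "exp (- (\<i> * (of_real pi * a / 2))) * (\<i> * of_real x) powr a = of_real x powr a"
      by (simp add: exp_minus mult.commute[of _ \<i>] mult_ac)
    have "F a = exp (- (\<i> * (of_real pi * a / 2))) *
        (exp (\<i> * of_real x * of_real \<nu>) * reg_lower_gamma a (\<i> * of_real x * of_real (\<nu> - \<nu>0)))"
      by (simp only: F_def expo exp_add mult.assoc)
    also have "exp (\<i> * of_real x * of_real \<nu>) * reg_lower_gamma a (\<i> * of_real x * of_real (\<nu> - \<nu>0))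
        = (\<i> * of_real x) powr a * frac_exp a \<nu>0 \<nu> (\<i> * of_real x) / Gamma a"
      using that le x by (intro reg_lower_gamma_eq_frac_exp) auto
    also have "exp (- (\<i> * (of_real pi * a / 2))) * \<dots>
        = exp (- (\<i> * (of_real pi * a / 2))) * (\<i> * of_real x) powr a / Gamma a *
          frac_exp a \<nu>0 \<nu> (\<i> * of_real x)"
      by simp
    finally show ?thesis
      unfolding phase .
  qed
  have cnj_F: "cnj (F (cnj \<alpha>)) = of_real x powr \<alpha> / Gamma \<alpha> * frac_exp \<alpha> \<nu>0 \<nu> (- \<i> * of_real x)"
    using a x F[of "cnj \<alpha>"] by (simp add: cnj_frac_exp cnj_powr flip: cnj_Gamma)
  have "Re_cont F \<alpha> = of_real x powr \<alpha> / Gamma \<alpha> *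
      ((frac_exp \<alpha> \<nu>0 \<nu> (\<i> * of_real x) + frac_exp \<alpha> \<nu>0 \<nu> (- \<i> * of_real x)) / 2)"
    unfolding Re_cont_def F[OF a] cnj_F by (simp add: algebra_simps add_divide_distrib)
  also have "frac_exp \<alpha> \<nu>0 \<nu> (\<i> * of_real x) + frac_exp \<alpha> \<nu>0 \<nu> (- \<i> * of_real x)
      = (\<integral>\<mu>. of_real (\<nu> - \<mu>) powr (\<alpha> - 1) * exp (\<i> * of_real x * of_real \<mu>) +
            of_real (\<nu> - \<mu>) powr (\<alpha> - 1) * exp (- \<i> * of_real x * of_real \<mu>) \<partial>lborel_on {\<nu>0..\<nu>})"
    unfolding frac_exp_def
    by (intro Bochner_Integration.integral_add[symmetric] integrable_frac_exp a le)
  also have "\<dots> / 2 = (\<integral>\<mu>. of_real (\<nu> - \<mu>) powr (\<alpha> - 1) * cos (of_real \<mu> * of_real x) \<partial>lborel_on {\<nu>0..\<nu>})"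
    unfolding integral_divide_zero[symmetric]
    by (intro Bochner_Integration.integral_cong) (auto simp: cos_exp_eq algebra_simps add_divide_distrib)
  finally show ?thesis
    unfolding F_def .
qed

text \<open>Dividing by the power of \<open>z = \<i> * \<pi> - x\<close> cancels the power from the
  substitution entirely, so no phase appears. The exponentials of \<open>z * \<mu>\<close> and its
  conjugate then differ by a sine times \<open>exp (- \<mu> * x)\<close>.\<close>

lemma Im_cont_frac_exp:
  assumes a: "Re \<alpha> > 0" and le: "\<nu>0 \<le> \<nu>"
  shows "Im_cont (\<lambda>a. exp ((\<i> * of_real pi - of_real x) * of_real \<nu>) *
            (reg_lower_gamma a ((\<i> * of_real pi - of_real x) * of_real (\<nu> - \<nu>0)) /
             (\<i> * of_real pi - of_real x) powr a)) \<alpha>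
    = 1 / Gamma \<alpha> * (\<integral>\<mu>. of_real (\<nu> - \<mu>) powr (\<alpha> - 1) *
        (exp (- of_real \<mu> * of_real x) * of_real (sin (pi * \<mu>))) \<partial>lborel_on {\<nu>0..\<nu>})"
proof -
  define z where "z = \<i> * of_real pi - complex_of_real x"
  have z: "z \<noteq> 0"
    by (simp add: z_def complex_eq_iff)
  define F where "F = (\<lambda>a. exp (z * of_real \<nu>) * (reg_lower_gamma a (z * of_real (\<nu> - \<nu>0)) / z powr a))"
  have F: "F a = frac_exp a \<nu>0 \<nu> z / Gamma a" if "Re a > 0" for a
    using reg_lower_gamma_eq_frac_exp[OF that le z] z by (simp add: F_def field_simps)
  have cnj_F: "cnj (F (cnj \<alpha>)) = frac_exp \<alpha> \<nu>0 \<nu> (cnj z) / Gamma \<alpha>"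
    using a F[of "cnj \<alpha>"] by (simp add: cnj_frac_exp flip: cnj_Gamma)
  have "Im_cont F \<alpha> = 1 / Gamma \<alpha> * ((frac_exp \<alpha> \<nu>0 \<nu> z - frac_exp \<alpha> \<nu>0 \<nu> (cnj z)) / (2 * \<i>))"
    unfolding Im_cont_def F[OF a] cnj_F by (simp flip: diff_divide_distrib)
  also have "frac_exp \<alpha> \<nu>0 \<nu> z - frac_exp \<alpha> \<nu>0 \<nu> (cnj z)
      = (\<integral>\<mu>. of_real (\<nu> - \<mu>) powr (\<alpha> - 1) * exp (z * of_real \<mu>) -
            of_real (\<nu> - \<mu>) powr (\<alpha> - 1) * exp (cnj z * of_real \<mu>) \<partial>lborel_on {\<nu>0..\<nu>})"
    unfolding frac_exp_def
    by (intro Bochner_Integration.integral_diff[symmetric] integrable_frac_exp a le)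
  also have "\<dots> / (2 * \<i>) = (\<integral>\<mu>. of_real (\<nu> - \<mu>) powr (\<alpha> - 1) *
        (exp (- of_real \<mu> * of_real x) * of_real (sin (pi * \<mu>))) \<partial>lborel_on {\<nu>0..\<nu>})"
    unfolding integral_divide_zero[symmetric]
  proof (intro Bochner_Integration.integral_cong refl)
    fix \<mu> :: real
    have "- of_real \<mu> * of_real x + \<i> * of_real (pi * \<mu>) = z * of_real \<mu>"
      "- of_real \<mu> * of_real x + - (\<i> * of_real (pi * \<mu>)) = cnj z * of_real \<mu>"
      by (simp_all add: z_def algebra_simps)
    then have "exp (- of_real \<mu> * of_real x) * exp (\<i> * of_real (pi * \<mu>)) = exp (z * of_real \<mu>)"
      "exp (- of_real \<mu> * of_real x) * exp (- (\<i> * of_real (pi * \<mu>))) = exp (cnj z * of_real \<mu>)"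
      by (simp_all only: exp_add[symmetric])
    then have "exp (- of_real \<mu> * of_real x) * of_real (sin (pi * \<mu>))
        = (exp (z * of_real \<mu>) - exp (cnj z * of_real \<mu>)) / (2 * \<i>)"
      unfolding sin_of_real[symmetric] sin_exp_eq
      by (metis (no_types, opaque_lifting) right_diff_distrib times_divide_eq_right)
    then show "(of_real (\<nu> - \<mu>) powr (\<alpha> - 1) * exp (z * of_real \<mu>) -
            of_real (\<nu> - \<mu>) powr (\<alpha> - 1) * exp (cnj z * of_real \<mu>)) / (2 * \<i>)
        = of_real (\<nu> - \<mu>) powr (\<alpha> - 1) * (exp (- of_real \<mu> * of_real x) * of_real (sin (pi * \<mu>)))"
      by (simp only: right_diff_distrib times_divide_eq_right)
  qed
  finally show ?thesis
    unfolding F_def z_def .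
qed

section \<open>Fubini and the final formula\<close>

lemma borel_measurable_lborel_on_pair:
  fixes c :: "real \<Rightarrow> real \<Rightarrow> complex"
  assumes "continuous_on UNIV (\<lambda>p. c (fst p) (snd p))"
  shows "(\<lambda>(x, y). c x y) \<in> borel_measurable (lborel_on A \<Otimes>\<^sub>M lborel_on B)"
proof -
  have id: "(\<lambda>x. x) \<in> borel_measurable (lborel_on X)" for X
    by (intro measurable_restrict_space1) simp
  have "(\<lambda>p. (fst p, snd p)) \<in> lborel_on A \<Otimes>\<^sub>M lborel_on B \<rightarrow>\<^sub>M borel \<Otimes>\<^sub>M borel"
    using measurable_compose[OF measurable_fst id] measurable_compose[OF measurable_snd id]
    by (intro measurable_Pair)
  then have "(\<lambda>p. (fst p, snd p)) \<in> borel_measurable (lborel_on A \<Otimes>\<^sub>M lborel_on B)"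
    by (simp add: borel_prod)
  from measurable_compose[OF this borel_measurable_continuous_onI[OF assms]]
  show ?thesis
    by (simp add: case_prod_beta')
qed

text \<open>At \<open>x = 0\<close> the integrand over \<open>[0, \<pi>]\<close> has a junk value, since \<open>0 powr (- \<alpha>) = 0\<close>.\<close>

lemma
  fixes f g :: "real \<Rightarrow> complex"
  assumes int: "integrable (lborel_on A) g" and A: "A \<in> sets borel" and B: "B - {0} = A - {0}"
    and eq: "\<And>x. x \<in> A \<Longrightarrow> x \<noteq> 0 \<Longrightarrow> f x = g x"
  shows absolutely_integrable_on_off_0: "f absolutely_integrable_on B"
    and integral_off_0: "integral B f = integral\<^sup>L (lborel_on A) g"
proof -
  have neg: "negligible {x \<in> A - B. g x \<noteq> 0}" "negligible {x \<in> B - A. g x \<noteq> 0}"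
    by (rule negligible_subset[of "{0}"]; use B in auto)+
  have gB: "g absolutely_integrable_on B"
    by (rule absolutely_integrable_spike_set[OF lborel_on_absolutely_integrable[OF int A] neg])
  have eq': "f x = g x" if "x \<in> B - {0}" for x
    using eq that B by auto
  show "f absolutely_integrable_on B"
    by (rule absolutely_integrable_spike[OF gB negligible_sing eq'])
  have "integral B f = integral B g"
    using eq' by (intro integral_spike[of "{0}"]) auto
  also have "\<dots> = integral A g"
    by (rule integral_spike_set[OF neg(2,1)])
  finally show "integral B f = integral\<^sup>L (lborel_on A) g"
    using integral_eq_integral_lborel_on[OF int A] by simp
qed

lemma frac_integral_bessel_I:
  fixes \<alpha> t :: complex and \<nu> \<nu>0 :: real
  assumes a: "Re \<alpha> > 0" and t: "Re t > 0" and le: "\<nu>0 \<le> \<nu>"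
  defines "f \<equiv> (\<lambda>x::real. exp (t * cos (of_real x)) * of_real x powr (- \<alpha>) *
             Re_cont (\<lambda>a. exp (\<i> * (of_real (\<nu> * x) - of_real pi * a / 2)) *
                          reg_lower_gamma a (\<i> * of_real x * of_real (\<nu> - \<nu>0))) \<alpha>)"
    and "g \<equiv> (\<lambda>x::real. exp (- t * cosh (of_real x)) *
             Im_cont (\<lambda>a. exp ((\<i> * of_real pi - of_real x) * of_real \<nu>) *
                          (reg_lower_gamma a ((\<i> * of_real pi - of_real x) * of_real (\<nu> - \<nu>0)) /
                           (\<i> * of_real pi - of_real x) powr a)) \<alpha>)"
  shows "(\<lambda>\<mu>. of_real (\<nu> - \<mu>) powr (\<alpha> - 1) * bessel_I (of_real \<mu>) t)
        absolutely_integrable_on {\<nu>0..\<nu>}" (is ?P)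
    and "f absolutely_integrable_on {0..pi}" (is ?Q)
    and "g absolutely_integrable_on {0..}" (is ?R)
    and "frac_integral \<alpha> \<nu>0 (\<lambda>\<mu>. bessel_I (of_real \<mu>) t) \<nu> =
          1 / of_real pi * (integral {0..pi} f - integral {0..} g)" (is ?S)
proof -
  define M where "M = lborel_on {\<nu>0..\<nu>}"
  define w where "w = (\<lambda>\<mu>. complex_of_real (\<nu> - \<mu>) powr (\<alpha> - 1))"
  define c1 where "c1 = (\<lambda>\<mu> x::real. exp (t * cos (of_real x)) * cos (complex_of_real \<mu> * of_real x))"
  define c2 where "c2 = (\<lambda>\<mu> x::real. exp (- t * cosh (of_real x)) *
      (exp (- of_real \<mu> * of_real x) * complex_of_real (sin (pi * \<mu>))))"
  define N1 N2 where "N1 = lborel_on {0..pi}" and "N2 = lborel_on {0<..}"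
  \<comment> \<open>Bounds \<open>- \<mu>\<close> for every order in \<open>[\<nu>0, \<nu>]\<close>,
    so \<open>exp (m * x)\<close> covers the growth of \<open>exp (- \<mu> * x)\<close> for negative
    orders.\<close>
  define m where "m = max \<bar>\<nu>0\<bar> \<bar>\<nu>\<bar>"
  have sf: "sigma_finite_measure M" "sigma_finite_measure N1" "sigma_finite_measure N2"
    unfolding M_def N1_def N2_def by (intro sigma_finite_lborel_on; simp)+
  have w: "integrable M w"
    unfolding M_def w_def by (rule integrable_frac_kernel[OF a le])
  have K1: "integrable N1 (\<lambda>x. exp (norm t))"
    unfolding N1_def by (intro integrable_lborel_on_continuous continuous_intros)
  \<comment> \<open>The halved rate comes from \<open>cosh x \<ge> exp x / 2\<close>.\<close>
  have K2: "integrable N2 (\<lambda>x. exp (- (Re t / 2) * exp x + m * x))"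
    unfolding N2_def using t by (intro integrable_double_exp) simp
  have c1_meas: "(\<lambda>(\<mu>, x). c1 \<mu> x) \<in> borel_measurable (M \<Otimes>\<^sub>M N1)"
    unfolding M_def N1_def c1_def by (intro borel_measurable_lborel_on_pair continuous_intros)
  have c2_meas: "(\<lambda>(\<mu>, x). c2 \<mu> x) \<in> borel_measurable (M \<Otimes>\<^sub>M N2)"
    unfolding M_def N2_def c2_def cosh_def
    by (intro borel_measurable_lborel_on_pair continuous_intros)
  have bd1: "norm (c1 \<mu> x) \<le> exp (norm t)" for \<mu> x
  proof -
    have "norm (cos (complex_of_real \<mu> * of_real x)) \<le> 1"
      by (simp add: cos_of_real flip: of_real_mult)
    moreover have "Re (t * cos (of_real x)) \<le> norm t * \<bar>cos x\<bar>"
      using complex_Re_le_cmod[of "t * cos (of_real x)"] by (simp add: norm_mult cos_of_real)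
    then have "Re (t * cos (of_real x)) \<le> norm t"
      by (rule order_trans) (simp add: mult_left_le)
    ultimately have "norm (exp (t * cos (of_real x))) * norm (cos (complex_of_real \<mu> * of_real x)) \<le> exp (norm t) * 1"
      by (intro mult_mono) auto
    then show ?thesis
      by (simp add: c1_def norm_mult)
  qed
  have bd2: "norm (c2 \<mu> x) \<le> exp (- (Re t / 2) * exp x + m * x)"
    if "\<mu> \<in> space M" "x \<in> space N2" for \<mu> x
  proof -
    have x: "x > 0" and \<mu>: "- \<mu> \<le> m"
      using that by (auto simp: M_def N2_def m_def space_restrict_space)
    have cosh: "cosh (complex_of_real x) = of_real (cosh x)"
      by (simp add: cosh_def scaleR_conv_of_real exp_of_real flip: of_real_minus)
    have "exp x / 2 \<le> cosh x"
      by (simp add: cosh_def)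
    then have "Re t * (exp x / 2) \<le> Re t * cosh x"
      using t by (intro mult_left_mono) auto
    moreover have "- \<mu> * x \<le> m * x"
      using x \<mu> by (intro mult_right_mono) auto
    ultimately have "exp (- Re t * cosh x + - \<mu> * x) * \<bar>sin (pi * \<mu>)\<bar>
        \<le> exp (- (Re t / 2) * exp x + m * x) * 1"
      by (intro mult_mono) auto
    then show ?thesis
      unfolding exp_add[of "- Re t * cosh x"] by (simp add: c2_def cosh norm_mult mult.assoc)
  qed
  note F1 = fubini_weighted[OF sf(1,2) w K1 c1_meas bd1]
  have F2: "integrable M (\<lambda>\<mu>. w \<mu> * integral\<^sup>L N2 (c2 \<mu>))"
    "integrable N2 (\<lambda>x. \<integral>\<mu>. w \<mu> * c2 \<mu> x \<partial>M)"
    "(\<integral>\<mu>. w \<mu> * integral\<^sup>L N2 (c2 \<mu>) \<partial>M) = (\<integral>x. (\<integral>\<mu>. w \<mu> * c2 \<mu> x \<partial>M) \<partial>N2)"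
    by (rule fubini_weighted[OF sf(1,3) w K2 c2_meas bd2]; assumption)+
  have bessel: "bessel_I (of_real \<mu>) t = 1 / of_real pi * (integral\<^sup>L N1 (c1 \<mu>) - integral\<^sup>L N2 (c2 \<mu>))" for \<mu>
    unfolding bessel_I_integral[OF t] c1_def c2_def N1_def N2_def by simp
  have wb: "w \<mu> * bessel_I (of_real \<mu>) t =
      1 / of_real pi * (w \<mu> * integral\<^sup>L N1 (c1 \<mu>) - w \<mu> * integral\<^sup>L N2 (c2 \<mu>))" for \<mu>
    unfolding bessel by (simp add: field_simps)
  have int_wb: "integrable M (\<lambda>\<mu>. w \<mu> * bessel_I (of_real \<mu>) t)"
    unfolding wb by (intro integrable_mult_right Bochner_Integration.integrable_diff F1(1) F2(1))
  show ?P
    using int_wb unfolding M_def w_def by (rule lborel_on_absolutely_integrable) simp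
  define h1 where "h1 = (\<lambda>x. 1 / Gamma \<alpha> * (\<integral>\<mu>. w \<mu> * c1 \<mu> x \<partial>M))"
  define h2 where "h2 = (\<lambda>x. 1 / Gamma \<alpha> * (\<integral>\<mu>. w \<mu> * c2 \<mu> x \<partial>M))"
  have h1: "integrable N1 h1" and h2: "integrable N2 h2"
    unfolding h1_def h2_def by (intro integrable_mult_right F1(2) F2(2))+
  have f_h1: "f x = h1 x" if "x \<in> {0..pi}" "x \<noteq> 0" for x
  proof -
    have "(\<integral>\<mu>. w \<mu> * c1 \<mu> x \<partial>M) = exp (t * cos (of_real x)) * (\<integral>\<mu>. w \<mu> * cos (of_real \<mu> * of_real x) \<partial>M)"
      unfolding c1_def by (subst integral_mult_right_zero[symmetric]) (simp add: mult_ac)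
    \<comment> \<open>The apparent singularity of \<open>f\<close> at 0 is cancelled exactly, so
      \<open>f\<close> is integrable however large \<open>Re \<alpha>\<close> is.\<close>
    moreover have "complex_of_real x powr (- \<alpha>) * of_real x powr \<alpha> = 1"
      using that by (simp add: powr_minus)
    ultimately show ?thesis
      using that unfolding f_def h1_def
      by (subst Re_cont_frac_exp[OF a le]) (auto simp: M_def w_def mult_ac)
  qed
  have g_h2: "g x = h2 x" for x
  proof -
    have "(\<integral>\<mu>. w \<mu> * c2 \<mu> x \<partial>M) = exp (- t * cosh (of_real x)) *
        (\<integral>\<mu>. w \<mu> * (exp (- of_real \<mu> * of_real x) * of_real (sin (pi * \<mu>))) \<partial>M)"
      unfolding c2_def by (subst integral_mult_right_zero[symmetric]) (simp add: mult_ac)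
    then show ?thesis
      unfolding g_def h2_def Im_cont_frac_exp[OF a le] by (simp add: M_def w_def)
  qed
  note off1 = absolutely_integrable_on_off_0[OF h1[unfolded N1_def] _ _ f_h1]
    integral_off_0[OF h1[unfolded N1_def] _ _ f_h1]
  have R: "{0..} - {0} = {0<..} - {0::real}" by auto
  note off2 = absolutely_integrable_on_off_0[OF h2[unfolded N2_def] _ R g_h2]
    integral_off_0[OF h2[unfolded N2_def] _ R g_h2]
  show ?Q by (rule off1) auto
  show ?R by (rule off2) auto
  have "frac_integral \<alpha> \<nu>0 (\<lambda>\<mu>. bessel_I (of_real \<mu>) t) \<nu> = 1 / Gamma \<alpha> * (\<integral>\<mu>. w \<mu> * bessel_I (of_real \<mu>) t \<partial>M)"
    using integral_eq_integral_lborel_on[OF int_wb[unfolded M_def]]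
    by (simp add: frac_integral_def M_def w_def)
  also have "(\<integral>\<mu>. w \<mu> * bessel_I (of_real \<mu>) t \<partial>M) = 1 / of_real pi *
      ((\<integral>x. (\<integral>\<mu>. w \<mu> * c1 \<mu> x \<partial>M) \<partial>N1) - (\<integral>x. (\<integral>\<mu>. w \<mu> * c2 \<mu> x \<partial>M) \<partial>N2))"
    unfolding wb F1(3)[symmetric] F2(3)[symmetric]
    by (subst integral_mult_right_zero, subst Bochner_Integration.integral_diff[OF F1(1) F2(1)]) simp_all
  also have "1 / Gamma \<alpha> * \<dots> = 1 / of_real pi * (integral\<^sup>L N1 h1 - integral\<^sup>L N2 h2)"
    unfolding h1_def h2_def integral_mult_right_zero by (simp only: right_diff_distrib mult.left_commute)
  also have "integral\<^sup>L N1 h1 = integral {0..pi} f"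
    unfolding N1_def by (rule off1(2)[symmetric]) auto
  also have "integral\<^sup>L N2 h2 = integral {0..} g"
    unfolding N2_def by (rule off2(2)[symmetric]) auto
  finally show ?S .
qed

theorem mainTheorem9:
  fixes \<alpha> t :: complex and \<nu> \<nu>0 :: real
  assumes "Re \<alpha> > 0" and "Re t > 0" and "\<nu>0 \<le> \<nu>"
  shows
    "(\<lambda>\<mu>. of_real (\<nu> - \<mu>) powr (\<alpha> - 1) * bessel_I (of_real \<mu>) t)
        absolutely_integrable_on {\<nu>0..\<nu>}
    \<and>
    (\<alpha> \<in> \<real> \<longrightarrow>
      (let
         f = (\<lambda>x::real. exp (t * cos (of_real x)) * of_real x powr (- \<alpha>) *
               of_real (Re (exp (\<i> * (of_real (\<nu> * x) - of_real pi * \<alpha> / 2)) *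
                            reg_lower_gamma \<alpha> (\<i> * of_real x * of_real (\<nu> - \<nu>0)))));
         g = (\<lambda>x::real. exp (- t * cosh (of_real x)) *
               of_real (Im (exp ((\<i> * of_real pi - of_real x) * of_real \<nu>) *
                            (reg_lower_gamma \<alpha> ((\<i> * of_real pi - of_real x) * of_real (\<nu> - \<nu>0)) /
                             (\<i> * of_real pi - of_real x) powr \<alpha>))))
       in f absolutely_integrable_on {0..pi} \<and>
          g absolutely_integrable_on {0..} \<and>
          frac_integral \<alpha> \<nu>0 (\<lambda>\<mu>. bessel_I (of_real \<mu>) t) \<nu> =
            1 / of_real pi * (integral {0..pi} f - integral {0..} g)))
    \<and>
    (let
       f = (\<lambda>x::real. exp (t * cos (of_real x)) * of_real x powr (- \<alpha>) *
             Re_cont (\<lambda>a. exp (\<i> * (of_real (\<nu> * x) - of_real pi * a / 2)) *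
                          reg_lower_gamma a (\<i> * of_real x * of_real (\<nu> - \<nu>0))) \<alpha>);
       g = (\<lambda>x::real. exp (- t * cosh (of_real x)) *
             Im_cont (\<lambda>a. exp ((\<i> * of_real pi - of_real x) * of_real \<nu>) *
                          (reg_lower_gamma a ((\<i> * of_real pi - of_real x) * of_real (\<nu> - \<nu>0)) /
                           (\<i> * of_real pi - of_real x) powr a)) \<alpha>)
     in f absolutely_integrable_on {0..pi} \<and>
        g absolutely_integrable_on {0..} \<and>
        frac_integral \<alpha> \<nu>0 (\<lambda>\<mu>. bessel_I (of_real \<mu>) t) \<nu> =
          1 / of_real pi * (integral {0..pi} f - integral {0..} g))"
proof -
  note * = frac_integral_bessel_I[OF assms]
  show ?thesis
  proof (cases "\<alpha> \<in> \<real>")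
    case True
    show ?thesis
      using * unfolding Let_def Re_cont_real[OF True] Im_cont_real[OF True] by blast
  next
    case False
    then show ?thesis
      using * unfolding Let_def by blast
  qed
qed

end
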